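(* Let $v\in\mathbb{N}^n$ and let ${}_{\vee}(x)$, ${}_{\vee}(z)$ be two join irreducible elements of the multinomial lattice $\mathcal{L}(v)$. The pair $({}_{\vee}(x),{}_{\vee}(x)_{\star})$ belongs to the congruence $\theta({}_{\vee}(z),{}_{\vee}(z)_{\star})$ if and only if ${}_{\vee}(x)\,\unlhd^{\bullet}\,{}_{\vee}(z)$.
   Context: $\mathbb{N}$ is the set of non-negative integers. For $v=(v_1,\ldots,v_n)\in\mathbb{N}^n$, $\mathcal{L}(v)$ is the set of words over the alphabet $\{a_1,\ldots,a_n\}$ in which each letter $a_i$ occurs exactly $v_i$ times. It is ordered by the reflexive and transitive closure of the relation $\rightarrow$, where $w\rightarrow u$ iff $w=w_1a_ia_jw_2$ and $u=w_1a_ja_iw_2$ for some words $w_1,w_2$ and some $i<j$. This ordered set is a lattice. An element $j$ of a finite lattice is join irreducible if it has a unique lower cover, denoted $j_\star$. For elements $p,q$ of a lattice, $\theta(p,q)$ is the smallest lattice congruence containing the pair $(p,q)$. For a vector $x$ with $0\le x\le v$ let $\min_\vee x=\min\{i: x_i<v_i\}$ ($\infty$ if $x=v$) and $\max_\vee x=\max\{i: x_i>0\}$ ($-\infty$ if $x=0$). The join irreducible elements of $\mathcal{L}(v)$ are exactly the words ${}_{\vee}(x)=(a_1^{x_1}\cdots a_n^{x_n})(a_1^{v_1-x_1}\cdots a_n^{v_n-x_n})$ with $0\le x\le v$ and $\min_\vee x<\max_\vee x$, and such an $x$ is uniquely determined by the word. The pair $(\min_\vee x,\max_\vee x)$ is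 the principal plan of ${}_{\vee}(x)$. For join irreducibles ${}_{\vee}(x)$, ${}_{\vee}(z)$ with principal plans $(a,b)$ and $(e,f)$ respectively, ${}_{\vee}(x)\,\unlhd^{\bullet}\,{}_{\vee}(z)$ means: (i) $[e,f]\subseteq[a,b]$ and $z_i=x_i$ for all $i$ with $e<i<f$; (ii) $z_e=x_e-d_e$ where $d_e\in\{0,1\}$ and $d_e=0$ if $e=a$; (iii) $z_f=x_f+d_f$ where $d_f\in\{0,1\}$ and $d_f=0$ if $f=b$. *)

theory Defs
  imports "HOL-Algebra.Lattice"
begin

section \<open>Lower covers, join irreducibles and congruences\<close>

definition lower_cover :: "('a, 'b) gorder_scheme \<Rightarrow> 'a \<Rightarrow> 'a \<Rightarrow> bool" where
  "lower_cover L c j \<longleftrightarrow>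
     c \<in> carrier L \<and> j \<in> carrier L \<and> c \<sqsubset>\<^bsub>L\<^esub> j \<and>
     \<not> (\<exists>d\<in>carrier L. c \<sqsubset>\<^bsub>L\<^esub> d \<and> d \<sqsubset>\<^bsub>L\<^esub> j)"

definition join_irreducible :: "('a, 'b) gorder_scheme \<Rightarrow> 'a \<Rightarrow> bool" where
  "join_irreducible L j \<longleftrightarrow> j \<in> carrier L \<and> (\<exists>!c. lower_cover L c j)"

text \<open>The element written $j_\star$; meaningful only if \<open>j\<close> is join irreducible.\<close>

definition the_lower_cover :: "('a, 'b) gorder_scheme \<Rightarrow> 'a \<Rightarrow> 'a" where
  "the_lower_cover L j = (THE c. lower_cover L c j)"

definition lattice_congruence :: "('a, 'b) gorder_scheme \<Rightarrow> 'a rel \<Rightarrow> bool" where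
  "lattice_congruence L R \<longleftrightarrow>
     equiv (carrier L) R \<and>
     (\<forall>p p' q q'. (p, p') \<in> R \<longrightarrow> (q, q') \<in> R \<longrightarrow>
        (p \<squnion>\<^bsub>L\<^esub> q, p' \<squnion>\<^bsub>L\<^esub> q') \<in> R \<and> (p \<sqinter>\<^bsub>L\<^esub> q, p' \<sqinter>\<^bsub>L\<^esub> q') \<in> R)"

definition principal_congruence :: "('a, 'b) gorder_scheme \<Rightarrow> 'a \<Rightarrow> 'a \<Rightarrow> 'a rel" where
  "principal_congruence L p q = \<Inter> {R. lattice_congruence L R \<and> (p, q) \<in> R}"


section \<open>Multinomial lattices\<close>

text \<open>
  The letter $a_i$ is represented by the number \<open>i\<close>, a word by a list of numbers, and a
  vector in $\mathbb{N}^n$ by a function \<open>nat \<Rightarrow> nat\<close> of which only the values on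
  \<open>{1..n}\<close> are ever used.
\<close>

definition words :: "nat \<Rightarrow> (nat \<Rightarrow> nat) \<Rightarrow> nat list set" where
  "words n v = {w. set w \<subseteq> {1..n} \<and> (\<forall>i\<in>{1..n}. count_list w i = v i)}"

definition swap_step :: "nat list \<Rightarrow> nat list \<Rightarrow> bool" where
  "swap_step w u \<longleftrightarrow>
     (\<exists>w1 w2 i j. i < j \<and> w = w1 @ [i, j] @ w2 \<and> u = w1 @ [j, i] @ w2)"

definition multinomial_lattice :: "nat \<Rightarrow> (nat \<Rightarrow> nat) \<Rightarrow> nat list gorder" where
  "multinomial_lattice n v = \<lparr>carrier = words n v, eq = (=), le = swap_step\<^sup>*\<^sup>*\<rparr>"


section \<open>Join irreducible words and their plans\<close>

definition letter_powers :: "nat \<Rightarrow> (nat \<Rightarrow> nat) \<Rightarrow> nat list" where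
  "letter_powers n x = concat (map (\<lambda>i. replicate (x i) i) [1..<Suc n])"

definition vee_word :: "nat \<Rightarrow> (nat \<Rightarrow> nat) \<Rightarrow> (nat \<Rightarrow> nat) \<Rightarrow> nat list" where
  "vee_word n v x = letter_powers n x @ letter_powers n (\<lambda>i. v i - x i)"

text \<open>
  The minimum and the maximum below are intended for $0 \neq x \neq v$. In the two excluded cases,
  conventionally given the values $\infty$ and $-\infty$, the word \<open>vee_word n v x\<close> is the bottom
  of the lattice, hence not join irreducible and without a plan; \<open>Min {}\<close> and \<open>Max {}\<close> are
  therefore immaterial.
\<close>

definition min_vee :: "nat \<Rightarrow> (nat \<Rightarrow> nat) \<Rightarrow> (nat \<Rightarrow> nat) \<Rightarrow> nat" where
  "min_vee n v x = Min {i \<in> {1..n}. x i < v i}"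

definition max_vee :: "nat \<Rightarrow> (nat \<Rightarrow> nat) \<Rightarrow> nat" where
  "max_vee n x = Max {i \<in> {1..n}. x i > 0}"

definition principal_plan :: "nat \<Rightarrow> (nat \<Rightarrow> nat) \<Rightarrow> (nat \<Rightarrow> nat) \<Rightarrow> nat \<times> nat" where
  "principal_plan n v x = (min_vee n v x, max_vee n x)"

text \<open>
  The relation $\unlhd^{\bullet}$ between the join irreducible words of \<open>x\<close> and of \<open>z\<close>, each of
  which determines its vector on \<open>{1..n}\<close>. The equation $z_e = x_e - d_e$ is written
  additively, since subtraction on \<open>nat\<close> truncates.
\<close>

definition vee_rel :: "nat \<Rightarrow> (nat \<Rightarrow> nat) \<Rightarrow> (nat \<Rightarrow> nat) \<Rightarrow> (nat \<Rightarrow> nat) \<Rightarrow> bool" where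
  "vee_rel n v x z \<longleftrightarrow>
     (let (a, b) = principal_plan n v x; (e, f) = principal_plan n v z in
        {e..f} \<subseteq> {a..b} \<and>
        (\<forall>i. e < i \<and> i < f \<longrightarrow> z i = x i) \<and>
        (\<exists>d\<in>{0, 1}. z e + d = x e \<and> (e = a \<longrightarrow> d = 0)) \<and>
        (\<exists>d\<in>{0, 1}. z f = x f + d \<and> (f = b \<longrightarrow> d = 0)))"

end

theory Submission
  imports Defs "HOL-Library.Product_Lexorder"
begin

text \<open>
  A word is determined by its inversions: the pairs formed by a copy of a larger letter and a copy of
  a smaller letter that it precedes. A set of pairs is the inversion set of a word if and only if it
  is biclosed, the order of the lattice is inclusion of inversion sets (both follow from \<open>bubble_sort\<close>), and
  the inversions of a join are the transitive closure of the union (\<open>inversions_join\<close>). The join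
  irreducible word of \<open>x\<close> inverts exactly the copies up to the cut \<open>x j\<close> with the copies beyond the
  cut \<open>x i\<close>, for \<open>i < j\<close>; passing to its lower cover destroys the inversion at its only descent.

  If $x \unlhd^{\bullet} z$, one explicit word \<open>p\<close> suffices (\<open>ex_separating_word\<close>): it lies above the lower
  cover of the word of \<open>z\<close>, it is not above the word of \<open>x\<close>, but its join with the word of \<open>z\<close> is.
  Collapsing the word of \<open>z\<close> to its lower cover then collapses that join to \<open>p\<close>, and meeting with the
  word of \<open>x\<close> collapses \<open>x\<close> (\<open>in_principal_congruence\<close>).

  Conversely, call two words equivalent if they are above the same words of vectors \<open>y\<close> with
  $x \unlhd^{\bullet} y$. This equivalence is compatible with meets for trivial reasons. It is compatible with
  joins because a chain of inversions that makes such a word of \<open>y\<close> lie below a join can be cut into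
  pieces, each of which comes from one side and witnesses that a word of the same kind, with a shorter
  or equal plan, is below that side (\<open>vee_word_below_join\<close>). So the equivalence is a congruence. It
  collapses every join irreducible word that is not one of the chosen ones to its lower cover, but not
  the word of \<open>x\<close>; hence \<open>x\<close> is not collapsed by such a \<open>z\<close>.
\<close>

section \<open>Positions of letter copies\<close>

text \<open>
  A token \<open>(i, k)\<close> is the \<open>k\<close>-th copy of the letter \<open>i\<close>, copies being counted from 1; its
  position is the length of the shortest prefix that contains \<open>k\<close> copies of \<open>i\<close>, so positions
  also start at 1. On pairs, \<open><\<close> is the lexicographic order: it is the order in which the tokens
  occur in the smallest word.
\<close>
definition pos :: "nat list \<Rightarrow> nat \<times> nat \<Rightarrow> nat" where
  "pos w s = (LEAST m. snd s \<le> count_list (take m w) (fst s))"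

definition tok :: "nat list \<Rightarrow> nat \<Rightarrow> nat \<times> nat" where
  "tok w m = (w ! m, Suc (count_list (take m w) (w ! m)))"

definition tokens :: "nat \<Rightarrow> (nat \<Rightarrow> nat) \<Rightarrow> (nat \<times> nat) set" where
  "tokens n v = {(i, k). 1 \<le> i \<and> i \<le> n \<and> 1 \<le> k \<and> k \<le> v i}"

definition inversions :: "nat \<Rightarrow> (nat \<Rightarrow> nat) \<Rightarrow> nat list \<Rightarrow> (nat \<times> nat) rel" where
  "inversions n v w = {(s, t). s \<in> tokens n v \<and> t \<in> tokens n v \<and> t < s \<and> pos w s < pos w t}"

lemma finite_tokens: "finite (tokens n v)"
proof -
  have "tokens n v \<subseteq> Sigma {1..n} (\<lambda>i. {1..v i})"
    by (auto simp: tokens_def)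
  then show ?thesis by (rule finite_subset) auto
qed

lemma count_list_take_mono:
  "m \<le> m' \<Longrightarrow> count_list (take m w) i \<le> count_list (take m' w) i"
proof -
  assume "m \<le> m'"
  then have "take m' w = take m w @ take (m' - m) (drop m w)"
    by (metis le_add_diff_inverse take_add)
  then show ?thesis by simp
qed

text \<open>
  The position of \<open>s\<close> and the letter counts of prefixes determine each other; all later facts about
  positions come from this equivalence.
\<close>
lemma pos_le_iff:
  assumes "snd s \<le> count_list w (fst s)"
  shows "pos w s \<le> m \<longleftrightarrow> snd s \<le> count_list (take m w) (fst s)"
proof
  have "snd s \<le> count_list (take (length w) w) (fst s)" using assms by simp
  then have "snd s \<le> count_list (take (pos w s) w) (fst s)"
    unfolding pos_def by (rule LeastI)
  then show "pos w s \<le> m \<Longrightarrow> snd s \<le> count_list (take m w) (fst s)"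
    by (rule le_trans[OF _ count_list_take_mono])
next
  show "snd s \<le> count_list (take m w) (fst s) \<Longrightarrow> pos w s \<le> m"
    unfolding pos_def by (rule Least_le)
qed

lemma count_list_take_le: "count_list (take m w) i \<le> count_list w i"
proof -
  have "count_list w i = count_list (take m w) i + count_list (drop m w) i"
    by (metis append_take_drop_id count_list_append)
  then show ?thesis by simp
qed

lemma tok_le_count:
  assumes "m < length w"
  shows "snd (tok w m) \<le> count_list w (fst (tok w m))"
proof -
  have "snd (tok w m) = count_list (take (Suc m) w) (w ! m)"
    using assms by (simp add: tok_def take_Suc_conv_app_nth)
  then show ?thesis using count_list_take_le by (simp add: tok_def)
qed

lemma pos_tok:
  assumes "m < length w"
  shows "pos w (tok w m) = Suc m"
proof (rule antisym)
  show "pos w (tok w m) \<le> Suc m"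
    using assms by (simp add: pos_le_iff[OF tok_le_count]) (simp add: tok_def take_Suc_conv_app_nth)
  have "\<not> pos w (tok w m) \<le> m"
    using assms by (simp add: pos_le_iff[OF tok_le_count]) (simp add: tok_def)
  then show "Suc m \<le> pos w (tok w m)" by simp
qed

section \<open>Congruences of finite lattices\<close>

text \<open>
  In a finite poset every element strictly below \<open>j\<close> lies below some lower cover of \<open>j\<close>. If there is
  only one lower cover, it therefore dominates everything strictly below \<open>j\<close>.
\<close>
lemma (in lattice) below_the_lower_cover:
  assumes fin: "finite (carrier L)" and j: "join_irreducible L j"
  shows "lower_cover L (the_lower_cover L j) j"
    and "\<And>c. c \<in> carrier L \<Longrightarrow> c \<sqsubseteq> j \<Longrightarrow> c \<noteq> j \<Longrightarrow> c \<sqsubseteq> the_lower_cover L j"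
proof -
  have ex1: "\<exists>!c. lower_cover L c j" and jC: "j \<in> carrier L"
    using j by (auto simp: join_irreducible_def)
  show lc: "lower_cover L (the_lower_cover L j) j"
    unfolding the_lower_cover_def using ex1 by (rule theI')
  fix c assume c: "c \<in> carrier L" "c \<sqsubseteq> j" "c \<noteq> j"
  \<comment> \<open>Counting the elements below \<open>d\<close> turns maximality in the order into maximality of a number.\<close>
  define f where "f d = card {e \<in> carrier L. e \<sqsubseteq> d}" for d
  let ?P = "\<lambda>d. d \<in> carrier L \<and> c \<sqsubseteq> d \<and> d \<sqsubset> j"
  have "?P c" using c by (auto simp: lless_eq)
  moreover have "\<forall>d. ?P d \<longrightarrow> f d < Suc (card (carrier L))"
    using fin by (simp add: f_def less_Suc_eq_le card_mono)
  ultimately obtain d where d: "?P d" "\<And>d'. ?P d' \<Longrightarrow> f d' \<le> f d"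
    using ex_has_greatest_nat[of ?P c f] by blast
  have "lower_cover L d j"
    unfolding lower_cover_def
  proof (intro conjI notI)
    assume "\<exists>d'\<in>carrier L. d \<sqsubset> d' \<and> d' \<sqsubset> j"
    then obtain d' where d': "d' \<in> carrier L" "d \<sqsubset> d'" "d' \<sqsubset> j" by blast
    then have dd': "d \<sqsubseteq> d'" "d \<noteq> d'" by (simp_all add: lless_eq)
    have "c \<sqsubseteq> d'" by (rule le_trans[of c d d']) (use d(1) d'(1) dd' c(1) in simp_all)
    then have "f d' \<le> f d" using d(2) d' by blast
    moreover have "{e \<in> carrier L. e \<sqsubseteq> d} \<subset> {e \<in> carrier L. e \<sqsubseteq> d'}"
    proof
      show "{e \<in> carrier L. e \<sqsubseteq> d} \<subseteq> {e \<in> carrier L. e \<sqsubseteq> d'}"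
        using d(1) d'(1) dd' le_trans[of _ d d'] by blast
      have "\<not> d' \<sqsubseteq> d" using le_antisym[of d d'] d(1) d'(1) dd' by blast
      then show "{e \<in> carrier L. e \<sqsubseteq> d} \<noteq> {e \<in> carrier L. e \<sqsubseteq> d'}"
        using d'(1) by auto
    qed
    then have "f d < f d'" unfolding f_def using fin by (intro psubset_card_mono) auto
    ultimately show False by simp
  qed (use d jC in auto)
  then have "d = the_lower_cover L j" using lc ex1 by blast
  then show "c \<sqsubseteq> the_lower_cover L j" using d(1) by blast
qed

text \<open>
  The perspectivity argument: if \<open>z\<close> and \<open>z'\<close> are identified, then so are \<open>z \<squnion> p\<close> and
  \<open>z' \<squnion> p = p\<close>, hence also their meets with \<open>x\<close>, which are \<open>x\<close> and an element strictly below
  \<open>x\<close>. Joining with the lower cover of \<open>x\<close> identifies \<open>x\<close> with that cover.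
\<close>
lemma (in lattice) in_principal_congruence:
  assumes fin: "finite (carrier L)" and x: "join_irreducible L x"
    and C: "z \<in> carrier L" "z' \<in> carrier L" "p \<in> carrier L"
    and p: "z' \<sqsubseteq> p" "x \<sqsubseteq> z \<squnion> p" "\<not> x \<sqsubseteq> p"
  shows "(x, the_lower_cover L x) \<in> principal_congruence L z z'"
  unfolding principal_congruence_def
proof (intro InterI, clarify)
  fix R assume R: "lattice_congruence L R" and zz: "(z, z') \<in> R"
  let ?y = "the_lower_cover L x"
  have xC: "x \<in> carrier L" using x by (simp add: join_irreducible_def)
  have yx: "?y \<in> carrier L" "?y \<sqsubseteq> x"
    using below_the_lower_cover(1)[OF fin x] by (auto simp: lower_cover_def lless_eq)
  have refl: "(c, c) \<in> R" if "c \<in> carrier L" for c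
    using R that by (auto simp: lattice_congruence_def equiv_def refl_on_def)
  have join: "(a \<squnion> c, b \<squnion> c) \<in> R" and meet: "(a \<sqinter> c, b \<sqinter> c) \<in> R"
    if "(a, b) \<in> R" "c \<in> carrier L" for a b c
    using R that refl by (auto simp: lattice_congruence_def)
  have "z' \<squnion> p = p" using p C by (simp add: le_iff_meet)
  then have "((z \<squnion> p) \<sqinter> x, p \<sqinter> x) \<in> R"
    using meet[OF join[OF zz C(3)] xC] by simp
  moreover have "(z \<squnion> p) \<sqinter> x = x"
    using p C xC le_iff_join meet_comm[of L "z \<squnion> p" x] by simp
  ultimately have "(x \<squnion> ?y, (p \<sqinter> x) \<squnion> ?y) \<in> R" using join yx by metis
  moreover have "x \<squnion> ?y = x" using yx xC le_iff_meet join_comm[of L x ?y] by simp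
  moreover have "(p \<sqinter> x) \<squnion> ?y = ?y"
  proof -
    have "p \<sqinter> x \<noteq> x" using p(3) C xC meet_left by metis
    then have "p \<sqinter> x \<sqsubseteq> ?y"
      using below_the_lower_cover(2)[OF fin x] C xC meet_right by simp
    then show ?thesis using yx C xC by (simp add: le_iff_meet)
  qed
  ultimately show "(x, ?y) \<in> R" by simp
qed

text \<open>
  Two elements are identified if no element of \<open>S\<close> distinguishes them by lying below one and not below
  the other. Being below a meet is a conjunction, so compatibility with meets is free; compatibility
  with joins is the content of the hypothesis, stated one argument at a time.
\<close>
lemma (in lattice) lattice_congruence_detectors:
  assumes S: "S \<subseteq> carrier L"
    and join: "\<And>p p' q s. \<lbrakk>p \<in> carrier L; p' \<in> carrier L; q \<in> carrier L; s \<in> S;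
      \<And>t. t \<in> S \<Longrightarrow> t \<sqsubseteq> p \<longleftrightarrow> t \<sqsubseteq> p'; s \<sqsubseteq> p \<squnion> q\<rbrakk> \<Longrightarrow> s \<sqsubseteq> p' \<squnion> q"
  shows "lattice_congruence L
    {(p, p'). p \<in> carrier L \<and> p' \<in> carrier L \<and> (\<forall>s\<in>S. s \<sqsubseteq> p \<longleftrightarrow> s \<sqsubseteq> p')}"
    (is "lattice_congruence L ?R")
  unfolding lattice_congruence_def
proof (intro conjI allI impI)
  show "equiv (carrier L) ?R"
    by (rule equivI) (auto simp: refl_on_def sym_def trans_def)
  have jn: "(p \<squnion> q, p' \<squnion> q) \<in> ?R" if "(p, p') \<in> ?R" "q \<in> carrier L" for p p' q
  proof -
    have "s \<sqsubseteq> p' \<squnion> q" if "s \<in> S" "s \<sqsubseteq> p \<squnion> q" for s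
      by (rule join[of p p' q s]) (use that \<open>(p, p') \<in> ?R\<close> \<open>q \<in> carrier L\<close> in auto)
    moreover have "s \<sqsubseteq> p \<squnion> q" if "s \<in> S" "s \<sqsubseteq> p' \<squnion> q" for s
      by (rule join[of p' p q s]) (use that \<open>(p, p') \<in> ?R\<close> \<open>q \<in> carrier L\<close> in auto)
    ultimately show ?thesis using that by auto
  qed
  fix p p' q q' assume pq: "(p, p') \<in> ?R" "(q, q') \<in> ?R"
  have "(p \<squnion> q, p' \<squnion> q) \<in> ?R" "(q \<squnion> p', q' \<squnion> p') \<in> ?R"
    using jn pq by auto
  then show "(p \<squnion> q, p' \<squnion> q') \<in> ?R"
    by (simp add: join_comm[of L _ p'])
  have meet: "s \<sqsubseteq> a \<sqinter> b \<longleftrightarrow> s \<sqsubseteq> a \<and> s \<sqsubseteq> b"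
    if "s \<in> S" "a \<in> carrier L" "b \<in> carrier L" for s a b
  proof -
    have s: "s \<in> carrier L" using that S by blast
    then have "s \<sqsubseteq> a \<sqinter> b \<Longrightarrow> s \<sqsubseteq> a" "s \<sqsubseteq> a \<sqinter> b \<Longrightarrow> s \<sqsubseteq> b"
      using le_trans[of s "a \<sqinter> b" a] le_trans[of s "a \<sqinter> b" b] that(2,3) meet_left meet_right
      by simp_all
    then show ?thesis using meet_le[of s a b] s that(2,3) by blast
  qed
  show "(p \<sqinter> q, p' \<sqinter> q') \<in> ?R"
    using pq meet by auto
qed

section \<open>Inversion sets of words\<close>

context
  fixes n :: nat and v :: "nat \<Rightarrow> nat"
begin

abbreviation (input) "W \<equiv> words n v"
abbreviation (input) "Tok \<equiv> tokens n v"
abbreviation (input) "Inv \<equiv> inversions n v"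

lemma token_le_count:
  assumes "w \<in> W" "s \<in> Tok"
  shows "snd s \<le> count_list w (fst s)"
proof -
  have "fst s \<in> {1..n}" "snd s \<le> v (fst s)" using assms(2) by (auto simp: tokens_def)
  moreover have "\<forall>i\<in>{1..n}. count_list w i = v i" using assms(1) by (simp add: words_def)
  ultimately show ?thesis by simp
qed

lemma tok_in_tokens:
  assumes "w \<in> W" "m < length w"
  shows "tok w m \<in> Tok"
proof -
  have 1: "set w \<subseteq> {1..n}" "\<forall>i\<in>{1..n}. count_list w i = v i"
    using assms(1) by (simp_all add: words_def)
  then have "w ! m \<in> {1..n}" using nth_mem[OF assms(2)] by blast
  moreover from this have "count_list w (w ! m) = v (w ! m)" using 1(2) by (rule bspec[rotated])
  ultimately show ?thesis using tok_le_count[OF assms(2)] by (simp add: tokens_def tok_def)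
qed

lemma token_is_tok:
  assumes "w \<in> W" "s \<in> Tok"
  obtains m where "m < length w" "s = tok w m"
proof -
  note le = pos_le_iff[OF token_le_count[OF assms]]
  have "\<not> pos w s \<le> 0" unfolding le using assms(2) by (auto simp: tokens_def)
  then obtain m where m: "pos w s = Suc m" by (cases "pos w s") auto
  have 1: "snd s \<le> count_list (take (Suc m) w) (fst s)" using m le[of "Suc m"] by simp
  have 2: "\<not> snd s \<le> count_list (take m w) (fst s)" using m le[of m] by simp
  have 3: "m < length w"
  proof (rule ccontr)
    assume "\<not> m < length w"
    then have "take m w = w" by simp
    then show False using 2 token_le_count[OF assms] by simp
  qed
  have "w ! m = fst s" "snd s = Suc (count_list (take m w) (fst s))"
    using 1 2 3 by (auto simp: take_Suc_conv_app_nth split: if_splits)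
  then have "s = tok w m" by (simp add: tok_def prod_eq_iff)
  then show thesis using 3 that by blast
qed

lemma pos_inj:
  assumes "w \<in> W" "s \<in> Tok" "t \<in> Tok" "pos w s = pos w t"
  shows "s = t"
proof -
  obtain m m' where m: "m < length w" "s = tok w m" "m' < length w" "t = tok w m'"
    using token_is_tok[OF assms(1)] assms(2,3) by metis
  then show ?thesis using assms(4) by (simp add: pos_tok)
qed

lemma pos_copy_le:
  assumes "w \<in> W" "(i, k) \<in> Tok" "(i, k') \<in> Tok" "k \<le> k'"
  shows "pos w (i, k) \<le> pos w (i, k')"
proof -
  have "k' \<le> count_list (take (pos w (i, k')) w) i"
    using pos_le_iff[OF token_le_count[OF assms(1,3)], THEN iffD1, OF order_refl] by simp
  then show ?thesis
    using assms(4) by (intro pos_le_iff[OF token_le_count[OF assms(1,2)], THEN iffD2]) simp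
qed

lemma inversion_letters:
  assumes "w \<in> W" "((j, l), (i, k)) \<in> Inv w"
  shows "i < j"
proof (rule ccontr)
  assume "\<not> i < j"
  then have "i = j" "k < l" using assms(2) by (auto simp: inversions_def)
  then show False using pos_copy_le[OF assms(1), of i k l] assms(2)
    by (auto simp: inversions_def)
qed

lemma inversions_iff:
  assumes "i < j" "(i, k) \<in> Tok" "(j, l) \<in> Tok"
  shows "((j, l), (i, k)) \<in> Inv w \<longleftrightarrow> pos w (j, l) < pos w (i, k)"
  using assms by (simp add: inversions_def)

lemma pos_less_iff:
  assumes "w \<in> W" "s \<in> Tok" "t \<in> Tok"
  shows "pos w s < pos w t \<longleftrightarrow> (if t < s then (s, t) \<in> Inv w else s \<noteq> t \<and> (t, s) \<notin> Inv w)"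
proof (cases "s = t")
  case False
  then have "pos w s \<noteq> pos w t" using pos_inj[OF assms] by blast
  then show ?thesis using False assms(2,3) by (auto simp: inversions_def)
qed (use assms in \<open>auto simp: inversions_def\<close>)

text \<open>
  The positions are recovered from the order of the tokens alone. This is what makes a word the
  function of its inversion set.
\<close>
lemma pos_eq_card:
  assumes "w \<in> W" "s \<in> Tok"
  shows "pos w s = Suc (card {t \<in> Tok. pos w t < pos w s})"
proof -
  obtain m where m: "m < length w" "s = tok w m"
    using token_is_tok[OF assms] .
  have "{t \<in> Tok. pos w t < pos w s} = tok w ` {..<m}" (is "?A = _")
  proof (intro equalityI subsetI)
    fix t assume t: "t \<in> ?A"
    then obtain m' where "m' < length w" "t = tok w m'"
      using token_is_tok[OF assms(1)] by blast
    then show "t \<in> tok w ` {..<m}" using t m by (auto simp: pos_tok)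
  qed (use m in \<open>auto simp: pos_tok tok_in_tokens[OF assms(1)]\<close>)
  moreover have "inj_on (tok w) {..<m}"
  proof (rule inj_onI)
    fix c d assume "c \<in> {..<m}" "d \<in> {..<m}" "tok w c = tok w d"
    then have "Suc c = Suc d" using m(1) by (metis lessThan_iff less_trans pos_tok)
    then show "c = d" by simp
  qed
  ultimately show ?thesis using m by (simp add: card_image pos_tok)
qed

lemma length_words:
  assumes "w \<in> W"
  shows "length w = card Tok"
proof -
  have "Tok = tok w ` {..<length w}"
    using token_is_tok[OF assms] tok_in_tokens[OF assms] by blast
  moreover have "inj_on (tok w) {..<length w}"
    by (rule inj_onI) (metis lessThan_iff nat.inject pos_tok)
  ultimately show ?thesis by (simp add: card_image)
qed

lemma inversions_inject:
  assumes "w \<in> W" "u \<in> W" "Inv w = Inv u"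
  shows "w = u"
proof (rule nth_equalityI)
  show len: "length w = length u" using assms by (simp add: length_words)
  have pos: "pos w s = pos u s" if "s \<in> Tok" for s
  proof -
    have "{t \<in> Tok. pos w t < pos w s} = {t \<in> Tok. pos u t < pos u s}"
      using that assms by (auto simp: pos_less_iff)
    then show ?thesis using pos_eq_card[OF assms(1) that] pos_eq_card[OF assms(2) that] by simp
  qed
  fix m assume m: "m < length w"
  have "pos u (tok w m) = pos u (tok u m)"
    using pos[OF tok_in_tokens[OF assms(1) m]] m len by (simp add: pos_tok)
  then have "tok w m = tok u m"
    using pos_inj assms tok_in_tokens m len by metis
  then show "w ! m = u ! m" by (simp add: tok_def)
qed

lemma swap_step_words:
  assumes "w \<in> W" "swap_step w u"
  shows "u \<in> W"
proof -
  have "set u = set w" "count_list u c = count_list w c" for c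
    using assms(2) by (auto simp: swap_step_def)
  then show ?thesis using assms(1) by (simp add: words_def)
qed

text \<open>
  Exchanging two adjacent letters that are in increasing order adds exactly one inversion.
\<close>
lemma inversions_swap:
  assumes "w \<in> W" "Suc m < length w" "w ! m < w ! Suc m"
  defines "u \<equiv> take m w @ [w ! Suc m, w ! m] @ drop (Suc (Suc m)) w"
  shows "swap_step w u" "Inv u = insert (tok w (Suc m), tok w m) (Inv w)"
proof -
  let ?i = "w ! m" and ?j = "w ! Suc m"
  have w_eq: "w = take m w @ [?i, ?j] @ drop (Suc (Suc m)) w"
    using id_take_nth_drop[of m w] Cons_nth_drop_Suc[of "Suc m" w] assms(2) by simp
  then show step: "swap_step w u"
    unfolding swap_step_def u_def using assms(3) by (metis (no_types))
  have u: "u \<in> W" using swap_step_words[OF assms(1) step] .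
  have len: "length u = length w" using assms(1) u by (simp add: length_words)
  have tk: "tok u c = (if c = m then tok w (Suc m) else if c = Suc m then tok w m else tok w c)"
    if "c < length w" for c
  proof -
    consider "c < m" | "c = m" | "c = Suc m" | "Suc (Suc m) \<le> c"
      by linarith
    then show ?thesis
    proof cases
      case 1
      then have "take c u = take c w" "u ! c = w ! c"
        using assms(2) by (auto simp: u_def nth_append min_def)
      then show ?thesis using 1 by (simp add: tok_def)
    next
      case 2
      then show ?thesis using assms(2,3)
        by (simp add: u_def tok_def nth_append min_def take_Suc_conv_app_nth)
    next
      case 3
      then show ?thesis using assms(2,3)
        by (simp add: u_def tok_def nth_append min_def take_Suc_conv_app_nth)
    next
      case c: 4
      define d where "d = c - Suc (Suc m)"
      have 4: "c = Suc (Suc m) + d" using c by (simp add: d_def)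
      have a: "u ! c = w ! c" using 4 that assms(2)
        by (simp add: u_def nth_append min_def)
      have 5: "take c u = take m w @ [?j, ?i] @ take d (drop (Suc (Suc m)) w)"
        using 4 that assms(2) by (simp add: u_def min_def)
      have "take c w = take (Suc (Suc m)) w @ take d (drop (Suc (Suc m)) w)"
        unfolding 4 by (rule take_add)
      then have "take c w = take m w @ [?i, ?j] @ take d (drop (Suc (Suc m)) w)"
        using assms(2) by (simp add: take_Suc_conv_app_nth)
      then have "count_list (take c u) y = count_list (take c w) y" for y
        unfolding 5 by simp
      then show ?thesis using a 4 by (simp add: tok_def)
    qed
  qed
  have ps: "pos u s = (if s = tok w m then Suc (Suc m) else if s = tok w (Suc m) then Suc m else pos w s)"
    if "s \<in> Tok" for s
  proof -
    obtain c where c: "c < length w" "s = tok w c" using token_is_tok[OF assms(1) \<open>s \<in> Tok\<close>] .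
    have inj: "tok w a = tok w b \<longleftrightarrow> a = b" if "a < length w" "b < length w" for a b
      using that by (metis nat.inject pos_tok)
    have pu: "pos u (tok u a) = Suc a" if "a < length w" for a using that len by (simp add: pos_tok)
    consider "c = m" | "c = Suc m" | "c \<noteq> m" "c \<noteq> Suc m" by blast
    then show ?thesis
    proof cases
      case 1
      then show ?thesis using pu[of "Suc m"] tk[of "Suc m"] assms(2) c by simp
    next
      case 2
      then show ?thesis using pu[of m] tk[of m] assms(2) c inj[of "Suc m" m] by simp
    next
      case 3
      then show ?thesis using pu[of c] tk[of c] assms(2) c inj[of c m] inj[of c "Suc m"]
        by (simp add: pos_tok)
    qed
  qed
  have tm: "tok w m \<in> Tok" "tok w (Suc m) \<in> Tok" "tok w m < tok w (Suc m)"
    using assms(2,3) tok_in_tokens[OF assms(1)] by simp_all (simp add: tok_def)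
  have pm: "pos w (tok w m) = Suc m" "pos w (tok w (Suc m)) = Suc (Suc m)"
    using assms(2) by (simp_all add: pos_tok)
  have inj: "pos w s \<noteq> Suc m" "pos w s \<noteq> Suc (Suc m)"
    if "s \<in> Tok" "s \<noteq> tok w m" "s \<noteq> tok w (Suc m)" for s
    using that pos_inj[OF assms(1)] tm pm by metis+
  show "Inv u = insert (tok w (Suc m), tok w m) (Inv w)"
  proof -
    have "(s, t) \<in> Inv u \<longleftrightarrow> (s, t) = (tok w (Suc m), tok w m) \<or> (s, t) \<in> Inv w" for s t
    proof (cases "s \<in> Tok \<and> t \<in> Tok \<and> t < s")
      case True
      then have "pos u s < pos u t \<longleftrightarrow> (s, t) = (tok w (Suc m), tok w m) \<or> pos w s < pos w t"
        using ps[of s] ps[of t] inj[of s] inj[of t] tm pm by (auto split: if_splits)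
      then show ?thesis using True by (auto simp: inversions_def)
    qed (use tm in \<open>auto simp: inversions_def\<close>)
    then show ?thesis by auto
  qed
qed

section \<open>Sorting towards a biclosed set\<close>

definition cross :: "(nat \<times> nat) rel" where
  "cross = {(s, t). s \<in> Tok \<and> t \<in> Tok \<and> fst t < fst s}"

text \<open>
  The sets that are closed under composition and whose complements are closed as well. They turn out
  to be exactly the inversion sets of words. Pairs of copies of one letter are excluded by
  \<open>T \<subseteq> cross\<close>, while the second closure condition still ranges over such copies: it says that
  copies of a letter keep their order.
\<close>
definition biclosed :: "(nat \<times> nat) rel \<Rightarrow> bool" where
  "biclosed T \<longleftrightarrow> T \<subseteq> cross \<and> trans T \<and>
     (\<forall>s t u. (s, u) \<in> T \<longrightarrow> t \<in> Tok \<longrightarrow> u < t \<longrightarrow> t < s \<longrightarrow> (s, t) \<in> T \<or> (t, u) \<in> T)"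

lemma finite_cross: "finite cross"
proof (rule finite_subset)
  show "cross \<subseteq> Tok \<times> Tok" by (auto simp: cross_def)
qed (simp add: finite_tokens)

lemma inversions_subset_cross:
  assumes "w \<in> W"
  shows "Inv w \<subseteq> cross"
proof (rule subrelI)
  fix s t assume st: "(s, t) \<in> Inv w"
  then have "fst t < fst s" using inversion_letters[OF assms, of "fst s" "snd s" "fst t" "snd t"] by simp
  then show "(s, t) \<in> cross" using st by (simp add: inversions_def cross_def)
qed

lemma biclosed_inversions:
  assumes "w \<in> W"
  shows "biclosed (Inv w)"
  unfolding biclosed_def
proof (intro conjI allI impI)
  show "Inv w \<subseteq> cross" by (rule inversions_subset_cross[OF assms])
  show "trans (Inv w)"
    unfolding inversions_def by (rule transI) (auto intro: less_trans simp del: less_prod_simp)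
next
  fix s t u assume "(s, u) \<in> Inv w" "t \<in> Tok" "u < t" "t < s"
  then show "(s, t) \<in> Inv w \<or> (t, u) \<in> Inv w"
    by (auto simp: inversions_def simp del: less_prod_simp)
qed

text \<open>
  The arrangement of the tokens whose inversions are \<open>T\<close>; it is transitive precisely because \<open>T\<close>
  is biclosed.
\<close>
definition less_of :: "(nat \<times> nat) rel \<Rightarrow> nat \<times> nat \<Rightarrow> nat \<times> nat \<Rightarrow> bool" where
  "less_of T s t \<longleftrightarrow> (if t < s then (s, t) \<in> T else s \<noteq> t \<and> (t, s) \<notin> T)"

lemma less_of_trans:
  assumes T: "biclosed T" and "s \<in> Tok" "t \<in> Tok" "u \<in> Tok" "less_of T s t" "less_of T t u"
  shows "less_of T s u"
proof -
  have co: "(a, b) \<in> T \<or> (b, c) \<in> T" if "(a, c) \<in> T" "c < b" "b < a" "b \<in> Tok" for a b c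
    using T that unfolding biclosed_def by blast
  have tr: "(a, c) \<in> T" if "(a, b) \<in> T" "(b, c) \<in> T" for a b c
    using T that unfolding biclosed_def trans_def by blast
  have st: "t < s \<Longrightarrow> (s, t) \<in> T" "\<not> t < s \<Longrightarrow> s < t \<and> (t, s) \<notin> T"
    using assms(5) unfolding less_of_def by (auto split: if_splits simp del: less_prod_simp)
  have tu: "u < t \<Longrightarrow> (t, u) \<in> T" "\<not> u < t \<Longrightarrow> t < u \<and> (u, t) \<notin> T"
    using assms(6) unfolding less_of_def by (auto split: if_splits simp del: less_prod_simp)
  have su: "s \<noteq> u" using st tu by (metis less_asym)
  show ?thesis
  proof (cases "u < s")
    case True
    consider "u < t" "t < s" | "s < t" | "t < u"
      using st tu True by (metis linorder_less_linear)
    then have "(s, u) \<in> T"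
    proof cases
      case 1
      then show ?thesis using st(1) tu(1) tr by blast
    next
      case 2
      then have "(t, u) \<in> T" "(t, s) \<notin> T" using st tu True less_asym less_trans by blast+
      then show ?thesis using co[of t u s] 2 True assms(2) by blast
    next
      case 3
      then have "(s, t) \<in> T" "(u, t) \<notin> T" using st tu True less_asym less_trans by blast+
      then show ?thesis using co[of s t u] 3 True assms(4) by blast
    qed
    then show ?thesis using True by (simp add: less_of_def del: less_prod_simp)
  next
    case False
    then have su': "s < u" using su by (metis linorder_less_linear)
    have "(u, s) \<notin> T"
    proof
      assume us: "(u, s) \<in> T"
      consider "s < t" "t < u" | "u < t" | "t < s"
        using st tu su' by (metis linorder_less_linear)
      then show False
      proof cases
        case 1
        then show ?thesis using co[OF us, of t] st tu assms(3) less_asym by blast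
      next
        case 2
        then have "(t, u) \<in> T" "(t, s) \<notin> T" using st tu su' less_asym less_trans by blast+
        then show ?thesis using tr us by blast
      next
        case 3
        then have "(s, t) \<in> T" "(u, t) \<notin> T" using st tu su' less_asym less_trans by blast+
        then show ?thesis using tr us by blast
      qed
    qed
    then show ?thesis using False su by (simp add: less_of_def del: less_prod_simp)
  qed
qed

text \<open>
  Among the steps available from \<open>w\<close>, take any that creates an inversion belonging to \<open>T\<close>. When no
  such step is left, consecutive tokens of \<open>w\<close> are in the order prescribed by \<open>T\<close>; that order is
  transitive, so \<open>w\<close> is sorted by it and its inversions are \<open>T\<close>. The lemma serves three purposes:
  it compares the order of words with inclusion of inversion sets, and it produces joins as well as
  words with prescribed inversions.
\<close>
lemma bubble_sort:
  assumes "w \<in> W" and T: "biclosed T" and "Inv w \<subseteq> T"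
  shows "\<exists>u\<in>W. swap_step\<^sup>*\<^sup>* w u \<and> Inv u = T"
  using assms(1,3)
proof (induction "card (T - Inv w)" arbitrary: w rule: less_induct)
  case (less w)
  have TC: "T \<subseteq> cross" using T by (simp add: biclosed_def)
  show ?case
  proof (cases "\<exists>m. Suc m < length w \<and> (tok w (Suc m), tok w m) \<in> T - Inv w")
    case True
    then obtain m where m: "Suc m < length w" "(tok w (Suc m), tok w m) \<in> T - Inv w" by blast
    then have "w ! m < w ! Suc m" using TC by (auto simp: cross_def tok_def)
    from inversions_swap[OF less.prems(1) m(1) this] obtain u
      where u: "swap_step w u" "Inv u = insert (tok w (Suc m), tok w m) (Inv w)" by blast
    have "u \<in> W" using swap_step_words[OF less.prems(1) u(1)] .
    moreover have "Inv u \<subseteq> T" using u(2) m(2) less.prems(2) by auto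
    moreover have "card (T - Inv u) < card (T - Inv w)"
    proof (rule psubset_card_mono)
      show "finite (T - Inv w)" using finite_subset[OF TC finite_cross] by simp
      show "T - Inv u \<subset> T - Inv w" using u(2) m(2) by blast
    qed
    ultimately obtain u' where "u' \<in> W" "swap_step\<^sup>*\<^sup>* u u'" "Inv u' = T"
      using less.hyps by blast
    then show ?thesis using converse_rtranclp_into_rtranclp[of swap_step, OF u(1)] by blast
  next
    case False
    have tk: "tok w m \<in> Tok" if "m < length w" for m
      using tok_in_tokens[OF less.prems(1) that] .
    have adj: "less_of T (tok w m) (tok w (Suc m))" if m: "Suc m < length w" for m
    proof -
      let ?s = "tok w m" and ?t = "tok w (Suc m)"
      have p: "pos w ?s < pos w ?t" using m by (simp add: pos_tok)
      then have "?t < ?s \<Longrightarrow> (?s, ?t) \<in> Inv w" "(?t, ?s) \<notin> Inv w" "?s \<noteq> ?t"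
        using tk m by (auto simp: inversions_def simp del: less_prod_simp)
      then show ?thesis using False m less.prems(2) by (auto simp: less_of_def simp del: less_prod_simp)
    qed
    have lt: "less_of T (tok w m) (tok w (m + Suc d))" if "m + Suc d < length w" for m d
      using that
    proof (induction d)
      case (Suc d)
      then have "less_of T (tok w m) (tok w (m + Suc d))" by simp
      moreover have "less_of T (tok w (m + Suc d)) (tok w (m + Suc (Suc d)))"
        using adj[of "m + Suc d"] Suc.prems by simp
      ultimately show ?case using less_of_trans[OF T tk tk tk, of m "m + Suc d" "m + Suc (Suc d)"] Suc.prems by simp
    qed (use adj in simp)
    have "T \<subseteq> Inv w"
    proof (rule subrelI)
      fix s t assume st: "(s, t) \<in> T"
      then have tok: "s \<in> Tok" "t \<in> Tok" "t < s"
        using TC by (auto simp: cross_def less_prod_def)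
      then obtain a b where ab: "a < length w" "s = tok w a" "b < length w" "t = tok w b"
        using token_is_tok[OF less.prems(1)] by metis
      have "\<not> b < a"
      proof
        assume "b < a"
        then obtain d where "a = b + Suc d" by (metis add_Suc_right less_imp_Suc_add)
        then have "less_of T t s" using lt ab by blast
        then show False using st tok(3) by (auto simp: less_of_def simp del: less_prod_simp)
      qed
      moreover have "a \<noteq> b" using ab tok(3) by auto
      ultimately show "(s, t) \<in> Inv w" using ab tok by (simp add: inversions_def pos_tok)
    qed
    then show ?thesis using less.prems by blast
  qed
qed

lemma swap_steps_inversions:
  assumes "swap_step\<^sup>*\<^sup>* w u" "w \<in> W"
  shows "u \<in> W \<and> Inv w \<subseteq> Inv u"
  using assms
proof (induction rule: rtranclp_induct)
  case (step y z)
  then have y: "y \<in> W" "Inv w \<subseteq> Inv y" by auto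
  obtain w1 w2 i j where ij: "i < j" "y = w1 @ [i, j] @ w2" "z = w1 @ [j, i] @ w2"
    using step.hyps(2) unfolding swap_step_def by blast
  have "Inv z = insert (tok y (Suc (length w1)), tok y (length w1)) (Inv y)"
    using inversions_swap(2)[OF y(1), of "length w1"] ij by (simp add: nth_append)
  then show ?case using y swap_step_words[OF y(1) step.hyps(2)] by blast
qed auto

lemma swap_steps_iff:
  assumes "w \<in> W" "u \<in> W"
  shows "swap_step\<^sup>*\<^sup>* w u \<longleftrightarrow> Inv w \<subseteq> Inv u"
proof
  assume "Inv w \<subseteq> Inv u"
  then obtain u' where "u' \<in> W" "swap_step\<^sup>*\<^sup>* w u'" "Inv u' = Inv u"
    using bubble_sort[OF assms(1) biclosed_inversions[OF assms(2)]] by blast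
  then show "swap_step\<^sup>*\<^sup>* w u" using inversions_inject assms(2) by metis
qed (use swap_steps_inversions assms in blast)

text \<open>
  The transitive closure of a union stays co-closed: a token that lies between the ends of a chain
  lies between the ends of one of its links, or is a vertex of the chain.
\<close>
lemma biclosed_trancl_Un:
  assumes "biclosed S" "biclosed T"
  shows "biclosed ((S \<union> T)\<^sup>+)"
  unfolding biclosed_def
proof (intro conjI allI impI)
  have ST: "S \<union> T \<subseteq> cross" using assms by (simp add: biclosed_def)
  have "(s, t) \<in> cross" if "(s, t) \<in> (S \<union> T)\<^sup>+" for s t
    using that
  proof (induction rule: trancl_induct)
    case (step y z)
    then have "(y, z) \<in> cross" using ST by blast
    then show ?case using step.IH by (auto simp: cross_def)
  qed (use ST in blast)
  then show "(S \<union> T)\<^sup>+ \<subseteq> cross" by auto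
  show "trans ((S \<union> T)\<^sup>+)" by (rule trans_trancl)
next
  fix s t u assume "(s, u) \<in> (S \<union> T)\<^sup>+" "t \<in> Tok" "u < t" "t < s"
  moreover have co: "(a, b) \<in> S \<union> T \<or> (b, c) \<in> S \<union> T"
    if "(a, c) \<in> S \<union> T" "c < b" "b < a" "b \<in> Tok" for a b c
    using assms that unfolding biclosed_def by blast
  ultimately show "(s, t) \<in> (S \<union> T)\<^sup>+ \<or> (t, u) \<in> (S \<union> T)\<^sup>+"
  proof (induction rule: trancl_induct)
    case (base y)
    then show ?case using co[of s y t] by blast
  next
    case (step y z)
    consider "t = y" | "t < y" | "y < t" by (metis linorder_less_linear)
    then show ?case
    proof cases
      case 2
      then have "(y, t) \<in> S \<union> T \<or> (t, z) \<in> S \<union> T" using step co by blast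
      then show ?thesis using step.hyps(1) by (meson r_into_trancl trancl_into_trancl)
    next
      case 3
      then have "(s, t) \<in> (S \<union> T)\<^sup>+ \<or> (t, y) \<in> (S \<union> T)\<^sup>+" using step co by blast
      then show ?thesis using step.hyps(2) by (meson trancl_into_trancl)
    qed (use step.hyps in blast)
  qed
qed

text \<open>
  Sorting the tokens by an integer key produces a biclosed set of inversions. Different tokens may
  have equal keys, which then leaves them uninverted; only the copies of one letter have to be in
  weakly increasing order.
\<close>
lemma biclosed_key:
  fixes K :: "nat \<times> nat \<Rightarrow> int"
  assumes mono: "\<And>i k k'. (i, k) \<in> Tok \<Longrightarrow> (i, k') \<in> Tok \<Longrightarrow> k \<le> k' \<Longrightarrow> K (i, k) \<le> K (i, k')"
  shows "biclosed {(s, t) \<in> cross. K s < K t}"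
  unfolding biclosed_def
proof (intro conjI allI impI)
  show "trans {(s, t) \<in> cross. K s < K t}" by (rule transI) (auto simp: cross_def)
next
  fix s t u :: "nat \<times> nat"
  assume a: "(s, u) \<in> {(s, t) \<in> cross. K s < K t}" "t \<in> Tok" "u < t" "t < s"
  have mono': "K p \<le> K q" if "p \<in> Tok" "q \<in> Tok" "fst p = fst q" "p < q" for p q
    using mono[of "fst p" "snd p" "snd q"] that by (cases p; cases q) auto
  have "K t \<le> K s" if "fst t = fst s"
    using mono'[of t s] that a by (auto simp: cross_def)
  moreover have "K u \<le> K t" if "fst t = fst u"
    using mono'[of u t] that a by (auto simp: cross_def)
  moreover have "fst t = fst s \<or> (s, t) \<in> cross" "fst t = fst u \<or> (t, u) \<in> cross"
    using a by (auto simp: cross_def less_prod_def)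
  ultimately show "(s, t) \<in> {(s, t) \<in> cross. K s < K t} \<or> (t, u) \<in> {(s, t) \<in> cross. K s < K t}"
    using a(1) by force
qed auto

section \<open>Inversions of the join irreducible words\<close>

lemma letter_powers_Suc:
  "letter_powers (Suc m) x = letter_powers m x @ replicate (x (Suc m)) (Suc m)"
  by (simp add: letter_powers_def)

lemma set_letter_powers: "set (letter_powers m x) \<subseteq> {1..m}"
  by (auto simp: letter_powers_def)

lemma count_list_replicate: "count_list (replicate k a) b = (if a = b then k else 0)"
  by (induction k) auto

lemma count_list_letter_powers:
  "i \<in> {1..m} \<Longrightarrow> count_list (letter_powers m x) i = x i"
proof (induction m)
  case (Suc m)
  have "Suc m \<notin> set (letter_powers m x)" using set_letter_powers[of m x] by auto
  then show ?case using Suc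
    by (cases "i = Suc m") (auto simp: letter_powers_Suc count_list_replicate count_list_0_iff)
qed simp

lemma sorted_letter_powers: "sorted (letter_powers m x)"
proof (induction m)
  case (Suc m)
  then show ?case using set_letter_powers[of m x]
    by (fastforce simp: letter_powers_Suc sorted_append)
qed (simp add: letter_powers_def)

lemma count_list_take_sorted:
  assumes "sorted ys" "0 < count_list (take m ys) j" "i < j"
  shows "count_list (take m ys) i = count_list ys i"
proof -
  have "j \<in> set (take m ys)" using assms(2) by (metis count_notin less_irrefl)
  moreover have "sorted (take m ys @ drop m ys)" using assms(1) by simp
  ultimately have "\<forall>y\<in>set (drop m ys). j \<le> y" unfolding sorted_append by blast
  then have "count_list (drop m ys) i = 0" using assms(3) by (force simp: count_list_0_iff)
  then show ?thesis by (metis add.right_neutral append_take_drop_id count_list_append)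
qed

lemma vee_word_in_words:
  assumes "\<forall>i\<in>{1..n}. x i \<le> v i"
  shows "vee_word n v x \<in> W"
proof -
  have "count_list (vee_word n v x) i = v i" if "i \<in> {1..n}" for i
    using assms that by (simp add: vee_word_def count_list_letter_powers)
  moreover have "set (vee_word n v x) \<subseteq> {1..n}"
    using set_letter_powers by (simp add: vee_word_def)
  ultimately show ?thesis by (simp add: words_def)
qed

text \<open>
  The first block of \<open>vee_word n v x\<close> holds the copies \<open>l \<le> x j\<close> of each letter \<open>j\<close>, the second
  block the others, and both blocks are sorted. Inversions therefore occur only between a token of the
  first block and a token of the second.
\<close>
lemma inversions_vee_word:
  assumes x: "\<forall>i\<in>{1..n}. x i \<le> v i"
  shows "((j, l), (i, k)) \<in> Inv (vee_word n v x) \<longleftrightarrow>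
    (i, k) \<in> Tok \<and> (j, l) \<in> Tok \<and> i < j \<and> l \<le> x j \<and> x i < k"
proof (cases "(i, k) \<in> Tok \<and> (j, l) \<in> Tok \<and> i < j")
  case True
  let ?w = "vee_word n v x"
  define a b where "a = letter_powers n x" and "b = letter_powers n (\<lambda>i. v i - x i)"
  have w: "?w = a @ b" by (simp add: a_def b_def vee_word_def)
  have W: "?w \<in> W" by (rule vee_word_in_words[OF x])
  have ij: "i \<in> {1..n}" "j \<in> {1..n}" "1 \<le> l" "k \<le> v i" "i < j" using True by (auto simp: tokens_def)
  have ca: "count_list a i = x i" "count_list a j = x j" "count_list b i = v i - x i"
    using ij by (auto simp: a_def b_def count_list_letter_powers)
  have pj: "pos ?w (j, l) \<le> m \<longleftrightarrow> l \<le> count_list (take m ?w) j" for m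
    using pos_le_iff[OF token_le_count[OF W, of "(j, l)"], of m] True by simp
  have pi: "pos ?w (i, k) \<le> m \<longleftrightarrow> k \<le> count_list (take m ?w) i" for m
    using pos_le_iff[OF token_le_count[OF W, of "(i, k)"], of m] True by simp
  define P where "P = pos ?w (j, l)"
  have P: "l \<le> count_list (take P ?w) j" unfolding P_def using pj by blast
  have "pos ?w (j, l) < pos ?w (i, k) \<longleftrightarrow> count_list (take P ?w) i < k"
    using pi[of P] unfolding P_def by linarith
  also have "\<dots> \<longleftrightarrow> l \<le> x j \<and> x i < k"
  proof (cases "l \<le> x j")
    case l: True
    have "P \<le> length a" unfolding P_def pj using l by (simp add: w ca)
    then have tP: "take P ?w = take P a" by (simp add: w)
    have "count_list (take P a) i = x i"
      using count_list_take_sorted[of a P j i] P ij ca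
      by (simp add: tP a_def sorted_letter_powers)
    then show ?thesis using l tP by simp
  next
    case l: False
    have tP: "take P ?w = take P a @ take (P - length a) b" by (simp add: w)
    have "\<not> P \<le> length a"
    proof
      assume "P \<le> length a"
      then have "l \<le> count_list (take P a) j" using P by (simp add: w)
      then show False using l count_list_take_le[of P a j] ca by simp
    qed
    then have tP: "take P ?w = a @ take (P - length a) b" by (simp add: w)
    then have "0 < count_list (take (P - length a) b) j" using P l ca by simp
    then have "count_list (take (P - length a) b) i = v i - x i"
      using count_list_take_sorted[of b "P - length a" j i] ij ca
      by (simp add: b_def sorted_letter_powers)
    moreover have "x i \<le> v i" using x ij by blast
    ultimately show ?thesis using tP l ij ca by simp
  qed
  finally show ?thesis using True inversions_iff by blast
next
  case False
  have "((j, l), (i, k)) \<notin> Inv (vee_word n v x)"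
  proof
    assume inv: "((j, l), (i, k)) \<in> Inv (vee_word n v x)"
    have "i < j" by (rule inversion_letters[OF vee_word_in_words[OF x] inv])
    moreover have "(i, k) \<in> Tok" "(j, l) \<in> Tok" using inv unfolding inversions_def by simp_all
    ultimately show False using False by blast
  qed
  then show ?thesis using False by blast
qed

lemma bottom_word: "vee_word n v (\<lambda>_. 0) \<in> W" "Inv (vee_word n v (\<lambda>_. 0)) = {}"
proof -
  show "vee_word n v (\<lambda>_. 0) \<in> W" by (rule vee_word_in_words) simp
  show "Inv (vee_word n v (\<lambda>_. 0)) = {}"
    using inversions_vee_word[of "\<lambda>_. 0"] by (auto simp: tokens_def)
qed

lemma key_word:
  fixes K :: "nat \<times> nat \<Rightarrow> int"
  assumes mono: "\<And>i k k'. (i, k) \<in> Tok \<Longrightarrow> (i, k') \<in> Tok \<Longrightarrow> k \<le> k' \<Longrightarrow> K (i, k) \<le> K (i, k')"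
  shows "\<exists>w\<in>W. Inv w = {(s, t) \<in> cross. K s < K t}"
  using bubble_sort[OF bottom_word(1) biclosed_key[of K, OF mono]] by (auto simp: bottom_word(2))

section \<open>The multinomial lattice\<close>

abbreviation (input) "M \<equiv> multinomial_lattice n v"

lemma carrier_multinomial: "carrier M = W"
  by (simp add: multinomial_lattice_def)

lemma le_multinomial: "p \<in> W \<Longrightarrow> q \<in> W \<Longrightarrow> p \<sqsubseteq>\<^bsub>M\<^esub> q \<longleftrightarrow> Inv p \<subseteq> Inv q"
  by (simp add: multinomial_lattice_def swap_steps_iff)

lemma finite_words: "finite W"
proof (rule inj_on_finite)
  show "inj_on Inv W" by (rule inj_onI) (rule inversions_inject)
  show "Inv ` W \<subseteq> Pow cross" using inversions_subset_cross by blast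
qed (simp add: finite_cross)

lemma ex_join_word:
  assumes "p \<in> W" "q \<in> W"
  shows "\<exists>r\<in>W. Inv r = (Inv p \<union> Inv q)\<^sup>+"
proof -
  have "Inv p \<subseteq> (Inv p \<union> Inv q)\<^sup>+" by auto
  then show ?thesis
    using bubble_sort[OF assms(1) biclosed_trancl_Un[OF assms[THEN biclosed_inversions]]] by blast
qed

lemma join_word_le:
  assumes "r \<in> W" "Inv p \<subseteq> Inv r" "Inv q \<subseteq> Inv r"
  shows "(Inv p \<union> Inv q)\<^sup>+ \<subseteq> Inv r"
proof (rule subrelI)
  fix s t assume "(s, t) \<in> (Inv p \<union> Inv q)\<^sup>+"
  then show "(s, t) \<in> Inv r"
  proof (induction rule: trancl_induct)
    case (step y z)
    have "trans (Inv r)" using biclosed_inversions[OF assms(1)] by (simp add: biclosed_def)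
    moreover have "(y, z) \<in> Inv r" using step.hyps(2) assms(2,3) by blast
    ultimately show ?case using step.IH by (meson transD)
  qed (use assms(2,3) in blast)
qed

text \<open>
  A lower bound with as many inversions as possible is the greatest one, since its join with any
  other lower bound is again a lower bound.
\<close>
lemma ex_meet_word:
  assumes "p \<in> W" "q \<in> W"
  shows "\<exists>m\<in>W. Inv m \<subseteq> Inv p \<and> Inv m \<subseteq> Inv q \<and>
    (\<forall>m'\<in>W. Inv m' \<subseteq> Inv p \<longrightarrow> Inv m' \<subseteq> Inv q \<longrightarrow> Inv m' \<subseteq> Inv m)"
proof -
  let ?P = "\<lambda>m. m \<in> W \<and> Inv m \<subseteq> Inv p \<and> Inv m \<subseteq> Inv q"
  have fin: "finite (Inv w)" if "w \<in> W" for w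
    using inversions_subset_cross[OF that] finite_cross by (rule finite_subset)
  have "?P (vee_word n v (\<lambda>_. 0))" using bottom_word by simp
  moreover have "\<forall>m. ?P m \<longrightarrow> card (Inv m) < Suc (card (Inv p))"
    using card_mono[OF fin[OF assms(1)]] by (simp add: less_Suc_eq_le)
  ultimately obtain m where m: "?P m" "\<And>m'. ?P m' \<Longrightarrow> card (Inv m') \<le> card (Inv m)"
    using ex_has_greatest_nat[of ?P "vee_word n v (\<lambda>_. 0)" "\<lambda>w. card (Inv w)"] by blast
  have "Inv m' \<subseteq> Inv m" if m': "?P m'" for m'
  proof -
    obtain r where r: "r \<in> W" "Inv r = (Inv m \<union> Inv m')\<^sup>+" using ex_join_word m(1) m' by blast
    then have "?P r" using join_word_le[of p m m'] join_word_le[of q m m'] assms m(1) m' by simp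
    then have "card (Inv r) \<le> card (Inv m)" by (rule m(2))
    moreover have "Inv m \<subseteq> Inv r" "Inv m' \<subseteq> Inv r" using r(2) by auto
    ultimately show ?thesis using card_seteq[OF fin[OF r(1)]] by blast
  qed
  then show ?thesis using m(1) by blast
qed

lemma lattice_multinomial: "lattice M"
proof -
  have eq: "eq M = (=)" by (simp add: multinomial_lattice_def)
  interpret partial_order M
  proof
    show "x .=\<^bsub>M\<^esub> y" if "x \<sqsubseteq>\<^bsub>M\<^esub> y" "y \<sqsubseteq>\<^bsub>M\<^esub> x" "x \<in> carrier M" "y \<in> carrier M" for x y
      using that inversions_inject by (auto simp: eq carrier_multinomial le_multinomial)
  qed (auto simp: eq carrier_multinomial le_multinomial)
  show ?thesis
  proof
    fix p q assume "p \<in> carrier M" "q \<in> carrier M"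
    then have pq: "p \<in> W" "q \<in> W" by (simp_all add: carrier_multinomial)
    from ex_join_word[OF pq] obtain r where r: "r \<in> W" "Inv r = (Inv p \<union> Inv q)\<^sup>+" by blast
    have "least M r (Upper M {p, q})"
    proof (rule least_UpperI)
      show "x \<sqsubseteq>\<^bsub>M\<^esub> r" if "x \<in> {p, q}" for x
        using that r pq by (auto simp: le_multinomial)
      show "r \<sqsubseteq>\<^bsub>M\<^esub> y" if "y \<in> Upper M {p, q}" for y
      proof -
        have y: "y \<in> W" "p \<sqsubseteq>\<^bsub>M\<^esub> y" "q \<sqsubseteq>\<^bsub>M\<^esub> y"
          using that pq by (auto simp: Upper_def carrier_multinomial)
        then show ?thesis using join_word_le[of y p q] r pq by (simp add: le_multinomial)
      qed
    qed (use pq r in \<open>auto simp: carrier_multinomial\<close>)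
    then show "\<exists>s. least M s (Upper M {p, q})" ..
    from ex_meet_word[OF pq] obtain m where m: "m \<in> W" "Inv m \<subseteq> Inv p" "Inv m \<subseteq> Inv q"
      "\<And>m'. m' \<in> W \<Longrightarrow> Inv m' \<subseteq> Inv p \<Longrightarrow> Inv m' \<subseteq> Inv q \<Longrightarrow> Inv m' \<subseteq> Inv m" by blast
    have "greatest M m (Lower M {p, q})"
    proof (rule greatest_LowerI)
      show "m \<sqsubseteq>\<^bsub>M\<^esub> x" if "x \<in> {p, q}" for x
        using that m(1-3) pq by (auto simp: le_multinomial)
      show "y \<sqsubseteq>\<^bsub>M\<^esub> m" if "y \<in> Lower M {p, q}" for y
      proof -
        have y: "y \<in> W" "y \<sqsubseteq>\<^bsub>M\<^esub> p" "y \<sqsubseteq>\<^bsub>M\<^esub> q"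
          using that pq by (auto simp: Lower_def carrier_multinomial)
        then show ?thesis using m(1,4) pq by (simp add: le_multinomial)
      qed
    qed (use pq m in \<open>auto simp: carrier_multinomial\<close>)
    then show "\<exists>s. greatest M s (Lower M {p, q})" ..
  qed
qed

lemma inversions_join:
  assumes "p \<in> W" "q \<in> W"
  shows "p \<squnion>\<^bsub>M\<^esub> q \<in> W" "Inv (p \<squnion>\<^bsub>M\<^esub> q) = (Inv p \<union> Inv q)\<^sup>+"
proof -
  interpret lattice M by (rule lattice_multinomial)
  show W: "p \<squnion>\<^bsub>M\<^esub> q \<in> W" using assms join_closed[of p q] by (simp add: carrier_multinomial)
  have le: "Inv p \<subseteq> Inv (p \<squnion>\<^bsub>M\<^esub> q)" "Inv q \<subseteq> Inv (p \<squnion>\<^bsub>M\<^esub> q)"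
    using assms W join_left[of p q] join_right[of p q]
    by (simp_all add: carrier_multinomial le_multinomial)
  obtain r where r: "r \<in> W" "Inv r = (Inv p \<union> Inv q)\<^sup>+" using ex_join_word[OF assms] by blast
  then have "p \<squnion>\<^bsub>M\<^esub> q \<sqsubseteq>\<^bsub>M\<^esub> r"
    using assms by (intro join_le) (auto simp: le_multinomial carrier_multinomial)
  then have "Inv (p \<squnion>\<^bsub>M\<^esub> q) \<subseteq> (Inv p \<union> Inv q)\<^sup>+" using W r by (simp add: le_multinomial)
  then show "Inv (p \<squnion>\<^bsub>M\<^esub> q) = (Inv p \<union> Inv q)\<^sup>+"
    using join_word_le[OF W le] by (rule subset_antisym)
qed

section \<open>Principal plans\<close>

text \<open>
  The vector \<open>z\<close> is bounded by \<open>v\<close>, its word is not the smallest one, and \<open>(e, f)\<close> is its principal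
  plan. Then \<open>f\<close> is the last letter of the first block and \<open>e\<close> the first letter of the second, so
  the last copy \<open>(f, z f)\<close> and the first copy \<open>(e, Suc (z e))\<close> form the only descent of the
  word.
\<close>
definition has_plan :: "(nat \<Rightarrow> nat) \<Rightarrow> nat \<Rightarrow> nat \<Rightarrow> bool" where
  "has_plan z e f \<longleftrightarrow> (\<forall>i\<in>{1..n}. z i \<le> v i) \<and> 1 \<le> e \<and> e < f \<and> f \<le> n \<and>
     (\<forall>i. 1 \<le> i \<and> i < e \<longrightarrow> z i = v i) \<and> z e < v e \<and>
     (\<forall>i. f < i \<and> i \<le> n \<longrightarrow> z i = 0) \<and> 0 < z f"

abbreviation (input) "V z \<equiv> vee_word n v z"

lemma has_planD:
  assumes "has_plan z e f"
  shows "\<forall>i\<in>{1..n}. z i \<le> v i" "1 \<le> e" "e < f" "f \<le> n" "z e < v e" "0 < z f"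
    "\<And>i. 1 \<le> i \<Longrightarrow> z i < v i \<Longrightarrow> e \<le> i" "\<And>i. i \<le> n \<Longrightarrow> 0 < z i \<Longrightarrow> i \<le> f"
    "V z \<in> W"
proof -
  show 1: "\<forall>i\<in>{1..n}. z i \<le> v i" and "1 \<le> e" "e < f" "f \<le> n" "z e < v e" "0 < z f"
    using assms by (simp_all add: has_plan_def)
  show "e \<le> i" if "1 \<le> i" "z i < v i" for i
    using assms that by (cases "e \<le> i") (auto simp: has_plan_def)
  show "i \<le> f" if "i \<le> n" "0 < z i" for i
    using assms that by (cases "i \<le> f") (auto simp: has_plan_def)
  show "V z \<in> W" by (rule vee_word_in_words[OF 1])
qed

lemma first_token:
  assumes "has_plan z e f" "1 \<le> i" "i \<le> n" "0 < z i"
  shows "(i, z i) \<in> Tok"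
  using assms by (simp add: tokens_def has_plan_def)

lemma second_token: "1 \<le> i \<Longrightarrow> i \<le> n \<Longrightarrow> z i < v i \<Longrightarrow> (i, Suc (z i)) \<in> Tok"
  by (simp add: tokens_def)

text \<open>
  A join irreducible word has a proper lower bound, hence an inversion. The letters of an inversion
  witness that the two sets defining the plan are nonempty and that the minimum of one is smaller than
  the maximum of the other.
\<close>
lemma join_irreducible_has_plan:
  assumes z: "\<forall>i\<in>{1..n}. z i \<le> v i" and irr: "join_irreducible M (V z)"
  shows "has_plan z (min_vee n v z) (max_vee n z)"
proof -
  let ?A = "{i \<in> {1..n}. z i < v i}" and ?B = "{i \<in> {1..n}. 0 < z i}"
  obtain c where "lower_cover M c (V z)" using irr by (auto simp: join_irreducible_def)
  then have c: "c \<in> W" "V z \<in> W" "c \<sqsubseteq>\<^bsub>M\<^esub> V z" "c \<noteq> V z"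
    by (auto simp: lower_cover_def carrier_multinomial lless_def multinomial_lattice_def)
  have "Inv (V z) \<noteq> {}"
  proof
    assume "Inv (V z) = {}"
    then have "Inv c = Inv (V z)" using c by (simp add: le_multinomial)
    then show False using inversions_inject c by blast
  qed
  then obtain y where "y \<in> Inv (V z)" by blast
  moreover obtain j l i k where "y = ((j, l), (i, k))" by (cases y) auto
  ultimately have "(i, k) \<in> Tok \<and> (j, l) \<in> Tok \<and> i < j \<and> l \<le> z j \<and> z i < k"
    using inversions_vee_word[OF z, of j l i k] by simp
  then have ij: "i < j" "i \<in> ?A" "j \<in> ?B" by (simp_all add: tokens_def)
  have fin: "finite ?A" "finite ?B" and ne: "?A \<noteq> {}" "?B \<noteq> {}"
    using ij(2,3) by (simp, simp, blast, blast)
  note Min = Min_in[OF fin(1) ne(1)] Min_le[OF fin(1)]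
  note Max = Max_in[OF fin(2) ne(2)] Max_ge[OF fin(2)]
  have "z c = v c" if "1 \<le> c" "c < Min ?A" for c
  proof (rule ccontr)
    assume "z c \<noteq> v c"
    moreover have "c \<le> n" using that Min(1) by simp
    ultimately have "c \<in> ?A" using z that by (simp add: nat_less_le)
    from Min(2)[OF this] that(2) show False by linarith
  qed
  moreover have "z c = 0" if "Max ?B < c" "c \<le> n" for c
  proof (rule ccontr)
    assume "z c \<noteq> 0"
    then have "c \<in> ?B" using that by simp
    from Max(2)[OF this] that(1) show False by linarith
  qed
  moreover have "Min ?A < Max ?B" using Min(2)[OF ij(2)] Max(2)[OF ij(3)] ij(1) by linarith
  moreover have "1 \<le> Min ?A" "z (Min ?A) < v (Min ?A)" using Min(1) by simp_all
  moreover have "Max ?B \<le> n" "0 < z (Max ?B)" using Max(1) by simp_all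
  ultimately show ?thesis
    using z unfolding has_plan_def min_vee_def max_vee_def by blast
qed

text \<open>
  Copies of a letter appear in order, so it is enough to test, for each pair of letters in the plan,
  the last copy in the first block against the first copy in the second block.
\<close>
lemma vee_word_below_iff:
  assumes z: "has_plan z e f" and w: "w \<in> W"
  shows "Inv (V z) \<subseteq> Inv w \<longleftrightarrow>
    (\<forall>i j. e \<le> i \<and> i < j \<and> j \<le> f \<and> z i < v i \<and> 0 < z j \<longrightarrow> pos w (j, z j) < pos w (i, Suc (z i)))"
    (is "_ \<longleftrightarrow> ?R")
proof
  note D = has_planD[OF z]
  assume sub: "Inv (V z) \<subseteq> Inv w"
  show ?R
  proof (intro allI impI)
    fix i j assume ij: "e \<le> i \<and> i < j \<and> j \<le> f \<and> z i < v i \<and> 0 < z j"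
    have "(j, z j) \<in> Tok" by (rule first_token[OF z]) (use ij D in auto)
    moreover have "(i, Suc (z i)) \<in> Tok" by (rule second_token) (use ij D in auto)
    ultimately have "((j, z j), (i, Suc (z i))) \<in> Inv (V z)"
      using ij inversions_vee_word[OF D(1)] by simp
    then have "((j, z j), (i, Suc (z i))) \<in> Inv w" using sub by blast
    then show "pos w (j, z j) < pos w (i, Suc (z i))" by (simp add: inversions_def)
  qed
next
  note D = has_planD[OF z]
  assume R: ?R
  show "Inv (V z) \<subseteq> Inv w"
  proof (rule subrelI)
    fix s t assume st: "(s, t) \<in> Inv (V z)"
    obtain j l i k where s: "s = (j, l)" and t: "t = (i, k)" by (cases s, cases t)
    have h: "(i, k) \<in> Tok" "(j, l) \<in> Tok" "i < j" "l \<le> z j" "z i < k"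
      using st inversions_vee_word[OF D(1)] unfolding s t by blast+
    then have h': "1 \<le> i" "j \<le> n" "z i < v i" "0 < z j" by (auto simp: tokens_def)
    have ij: "e \<le> i" "j \<le> f" using D(7,8) h' by blast+
    have "pos w (j, l) \<le> pos w (j, z j)"
      by (rule pos_copy_le[OF w]) (use h h' first_token[OF z, of j] in auto)
    also have "\<dots> < pos w (i, Suc (z i))" using R ij h h' by blast
    also have "\<dots> \<le> pos w (i, k)"
      by (rule pos_copy_le[OF w]) (use h h' second_token[of i z] in auto)
    finally show "(s, t) \<in> Inv w" using h by (simp add: s t inversions_iff)
  qed
qed

lemma pos_mono_non_inversion:
  assumes "w \<in> W" "s \<in> Tok" "t \<in> Tok" "s \<le> t" "(t, s) \<notin> Inv w"
  shows "pos w s \<le> pos w t"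
proof (rule ccontr)
  assume "\<not> pos w s \<le> pos w t"
  moreover from this have "s < t" using assms(4) by (auto simp: order_le_less)
  ultimately have "(t, s) \<in> Inv w"
    using assms(2,3) by (simp add: inversions_def del: less_prod_simp)
  then show False using assms(5) by blast
qed

text \<open>
  Below the word of \<open>z\<close>, each of its two blocks keeps its internal order. Any word that also inverts
  the descent, that is, the end of the first block and the beginning of the second, must then put
  the whole first block before the second in every relevant pair. So the lower cover does not invert
  the descent.
\<close>
lemma descent_only_on_top:
  assumes z: "has_plan z e f" and w: "w \<in> W" "Inv w \<subseteq> Inv (V z)"
    and desc: "((f, z f), (e, Suc (z e))) \<in> Inv w"
  shows "w = V z"
proof (rule inversions_inject[OF w(1)])
  note D = has_planD[OF z]
  have "Inv (V z) \<subseteq> Inv w"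
    unfolding vee_word_below_iff[OF z w(1)]
  proof (intro allI impI)
    fix i j assume ij: "e \<le> i \<and> i < j \<and> j \<le> f \<and> z i < v i \<and> 0 < z j"
    have j: "(j, z j) \<in> Tok" by (rule first_token[OF z]) (use ij D in auto)
    have i: "(i, Suc (z i)) \<in> Tok" by (rule second_token) (use ij D in auto)
    have f: "(f, z f) \<in> Tok" by (rule first_token[OF z]) (use D in auto)
    have e: "(e, Suc (z e)) \<in> Tok" by (rule second_token) (use D in auto)
    have "((f, z f), (j, z j)) \<notin> Inv (V z)" "((i, Suc (z i)), (e, Suc (z e))) \<notin> Inv (V z)"
      by (simp_all add: inversions_vee_word[OF D(1)])
    then have ni: "((f, z f), (j, z j)) \<notin> Inv w" "((i, Suc (z i)), (e, Suc (z e))) \<notin> Inv w"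
      using w(2) by blast+
    have "pos w (j, z j) \<le> pos w (f, z f)"
      by (rule pos_mono_non_inversion[OF w(1) j f _ ni(1)]) (use ij in \<open>cases "j = f"; auto\<close>)
    also have "\<dots> < pos w (e, Suc (z e))" using desc by (simp add: inversions_def)
    also have "\<dots> \<le> pos w (i, Suc (z i))"
      by (rule pos_mono_non_inversion[OF w(1) e i _ ni(2)]) (use ij in \<open>cases "i = e"; auto\<close>)
    finally show "pos w (j, z j) < pos w (i, Suc (z i))" .
  qed
  then show "Inv w = Inv (V z)" using w(2) by blast
qed (rule has_planD[OF z])

section \<open>Collapsing along the relation\<close>

text \<open>
  The relation $\unlhd^{\bullet}$, with explicit plans \<open>(a, b)\<close> of \<open>x\<close> and \<open>(e, f)\<close> of \<open>z\<close>: inside its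
  plan \<open>z\<close> splits the letters as \<open>x\<close> does, and its descent uses tokens next to the place where \<open>x\<close>
  cuts the copies of \<open>e\<close> and \<open>f\<close>.
\<close>
definition arc_le :: "(nat \<Rightarrow> nat) \<Rightarrow> nat \<Rightarrow> nat \<Rightarrow> (nat \<Rightarrow> nat) \<Rightarrow> nat \<Rightarrow> nat \<Rightarrow> bool" where
  "arc_le x a b z e f \<longleftrightarrow> a \<le> e \<and> f \<le> b \<and> (\<forall>i. e < i \<and> i < f \<longrightarrow> z i = x i) \<and>
     (z e = x e \<or> e \<noteq> a \<and> Suc (z e) = x e) \<and> (z f = x f \<or> f \<noteq> b \<and> z f = Suc (x f))"

lemma vee_rel_iff_arc_le:
  assumes "min_vee n v z < max_vee n z"
  shows "vee_rel n v x z \<longleftrightarrow>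
    arc_le x (min_vee n v x) (max_vee n x) z (min_vee n v z) (max_vee n z)"
proof -
  have 1: "(\<exists>d\<in>{0, 1}. p + d = q \<and> (P \<longrightarrow> d = 0)) \<longleftrightarrow> p = q \<or> \<not> P \<and> Suc p = q"
    for p q :: nat and P by auto
  have 2: "(\<exists>d\<in>{0, 1}. p = q + d \<and> (P \<longrightarrow> d = 0)) \<longleftrightarrow> p = q \<or> \<not> P \<and> p = Suc q"
    for p q :: nat and P by auto
  show ?thesis
    unfolding vee_rel_def principal_plan_def arc_le_def Let_def prod.case 1 2
    using assms by simp
qed

text \<open>
  The word \<open>p\<close> consists of the first block of \<open>x\<close> without a token \<open>t\<close>, then tokens \<open>s\<close> and \<open>t\<close>,
  then the second block of \<open>x\<close> without \<open>s\<close>; both remaining blocks are sorted decreasingly. Here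
  \<open>(t, s)\<close> is an inversion of the word of \<open>x\<close>, and it is the only one that \<open>p\<close> lacks. It reappears
  in the join with the word of \<open>z\<close> through a chain from \<open>t\<close> over the descent of \<open>z\<close> to \<open>s\<close>: when
  \<open>z e = x e\<close> the token \<open>s\<close> is the lower end of that descent, and otherwise that end is the last
  copy of \<open>e\<close> in the first block of \<open>x\<close>, which precedes \<open>s\<close> if \<open>s\<close> is chosen with the smaller
  letter \<open>a\<close>. The choice of \<open>t\<close> is symmetric.
\<close>
lemma ex_separating_word:
  assumes x: "has_plan x a b" and z: "has_plan z e f" and xz: "arc_le x a b z e f"
  shows "\<exists>p\<in>W. Inv (V z) - {((f, z f), (e, Suc (z e)))} \<subseteq> Inv p \<and>
    \<not> Inv (V x) \<subseteq> Inv p \<and> Inv (V x) \<subseteq> (Inv (V z) \<union> Inv p)\<^sup>+"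
proof -
  note X = has_planD[OF x] and Z = has_planD[OF z]
  have A: "a \<le> e" "f \<le> b" "\<And>i. e < i \<Longrightarrow> i < f \<Longrightarrow> z i = x i"
    "z e = x e \<or> e \<noteq> a \<and> Suc (z e) = x e" "z f = x f \<or> f \<noteq> b \<and> z f = Suc (x f)"
    using xz by (auto simp: arc_le_def)
  define g where "g = (if z e = x e then e else a)"
  define h where "h = (if z f = x f then f else b)"
  define s t where "s = (g, Suc (x g))" and "t = (h, x h)"
  have gh: "1 \<le> g" "g \<le> e" "f \<le> h" "h \<le> n" "g < h" "x g < v g" "0 < x h"
    using A X Z by (auto simp: g_def h_def)
  have ge: "g = e \<Longrightarrow> z e = x e" and hf: "h = f \<Longrightarrow> z f = x f"
    using A(4,5) by (auto simp: g_def h_def split: if_splits)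
  have stT: "s \<in> Tok" "t \<in> Tok" "(t, s) \<in> cross"
    using gh X(1) by (auto simp: s_def t_def tokens_def cross_def)
  \<comment> \<open>The four parts of \<open>p\<close> get the keys \<open>{- n..- 1}\<close>, \<open>0\<close>, \<open>1\<close> and \<open>{2..n + 1}\<close>;
  the signs make the letters decrease within the first and the last part.\<close>
  define K :: "nat \<times> nat \<Rightarrow> int" where "K y = (if y = s then 0 else if y = t then 1
    else if snd y \<le> x (fst y) then - int (fst y) else int n + 2 - int (fst y))" for y
  have Ks: "K s = 0" and Kt: "K t = 1" using gh(5) by (auto simp: K_def s_def t_def)
  have K1: "K (i, k) = - int i" if "k \<le> x i" "(i, k) \<noteq> t" for i k
    using that by (auto simp: K_def s_def)
  have K2: "K (i, k) = int n + 2 - int i" if "x i < k" "(i, k) \<noteq> s" for i k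
    using that by (auto simp: K_def t_def)
  have "\<exists>p\<in>W. Inv p = {(y, y') \<in> cross. K y < K y'}"
  proof (rule key_word)
    fix i k k' assume t1: "(i, k) \<in> Tok" "(i, k') \<in> Tok" "k \<le> k'"
    then have "1 \<le> i" "i \<le> n" by (auto simp: tokens_def)
    then show "K (i, k) \<le> K (i, k')"
      using t1(3) gh(5) by (auto simp: K_def s_def t_def)
  qed
  then obtain p where p: "p \<in> W" "Inv p = {(y, y') \<in> cross. K y < K y'}" by blast
  have key: "((j, l), (i, k)) \<in> Inv p"
    if "(i, k) \<in> Tok" "(j, l) \<in> Tok" "i < j" "l \<le> x j" "x i < k" "((j, l), (i, k)) \<noteq> (t, s)"
    for i j k l
  proof -
    have "1 \<le> j" "i \<le> n" using that by (auto simp: tokens_def)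
    then have "(j, l) \<noteq> t \<Longrightarrow> K (j, l) < 0" "(i, k) \<noteq> s \<Longrightarrow> 1 < K (i, k)"
      using that(4,5) K1[of l j] K2[of i k] by simp_all
    moreover have "(j, l) \<noteq> t \<or> (i, k) \<noteq> s" using that(6) by simp
    moreover have "(j, l) = t \<Longrightarrow> K (j, l) = 1" "(i, k) = s \<Longrightarrow> K (i, k) = 0"
      using Ks Kt by simp_all
    ultimately have "K (j, l) < K (i, k)" by linarith
    then show ?thesis using that by (simp add: p(2) cross_def)
  qed
  have "Inv (V z) - {((f, z f), (e, Suc (z e)))} \<subseteq> Inv p"
  proof (rule subrelI)
    fix y y' assume yy: "(y, y') \<in> Inv (V z) - {((f, z f), (e, Suc (z e)))}"
    obtain j l i k where y: "y = (j, l)" and y': "y' = (i, k)" by (cases y, cases y')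
    have h: "(i, k) \<in> Tok" "(j, l) \<in> Tok" "i < j" "l \<le> z j" "z i < k"
      using yy inversions_vee_word[OF Z(1)] unfolding y y' by blast+
    have nd: "\<not> (j = f \<and> l = z f \<and> i = e \<and> k = Suc (z e))" using yy by (auto simp: y y')
    have h': "1 \<le> i" "j \<le> n" "z i < v i" "0 < z j" "1 \<le> l" "k \<le> v i" using h by (auto simp: tokens_def)
    have ij: "e \<le> i" "j \<le> f" using Z(7,8) h' by blast+
    have c1: "l \<le> x j \<or> j = f \<and> l = z f \<and> z f = Suc (x f) \<and> f < h"
    proof (cases "j = f")
      case True
      then show ?thesis using A(5) h(4) gh(3) hf by (cases "h = f") auto
    next
      case False
      then have "z j = x j" using A(3)[of j] ij h(3) by simp
      then show ?thesis using h(4) by simp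
    qed
    have c2: "x i < k \<or> i = e \<and> k = Suc (z e) \<and> x e = Suc (z e) \<and> g < e"
    proof (cases "i = e")
      case True
      then show ?thesis using A(4) h(5) gh(2) ge by (cases "g = e") auto
    next
      case False
      then have "z i = x i" using A(3)[of i] ij h(3) by simp
      then show ?thesis using h(5) by simp
    qed
    \<comment> \<open>Either the tokens lie in different blocks of \<open>x\<close>, or exactly one of them is an end of the
    descent of \<open>z\<close> that lies on the other side of the cut of \<open>x\<close>; in the last two cases both lie in the
    same block, whose letters decrease in \<open>p\<close>.\<close>
    consider "l \<le> x j" "x i < k" | "l \<le> x j" "i = e" "k = Suc (z e)" "x e = Suc (z e)" "g < e"
      | "x i < k" "j = f" "l = z f" "z f = Suc (x f)" "f < h"
      using c1 c2 nd by blast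
    then have "(y, y') \<in> Inv p"
    proof cases
      case 1
      have "((j, l), (i, k)) \<noteq> (t, s)"
      proof
        assume "((j, l), (i, k)) = (t, s)"
        then have eq: "j = h" "l = x h" "i = g" "k = Suc (x g)" by (auto simp: s_def t_def)
        then have "g = e" "h = f" using gh(2,3) ij by simp_all
        then show False using nd eq ge hf by simp
      qed
      then show ?thesis using key h 1 by (simp add: y y')
    next
      case 2
      have "(j, l) \<noteq> t"
      proof
        assume "(j, l) = t"
        then have "j = h" "l = x h" by (simp_all add: t_def)
        moreover from this have "h = f" using gh(3) ij by simp
        ultimately show False using nd hf 2 by simp
      qed
      then have "K (j, l) = - int j" using K1 2 by simp
      moreover have "K (i, k) = - int i" using K1[of k i] 2 gh Z(3) by (auto simp: t_def)
      ultimately show ?thesis using h by (simp add: p(2) cross_def y y')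
    next
      case 3
      have "(i, k) \<noteq> s"
      proof
        assume "(i, k) = s"
        then have "i = g" "k = Suc (x g)" by (simp_all add: s_def)
        moreover from this have "g = e" using gh(2) ij by simp
        ultimately show False using nd ge 3 by simp
      qed
      then have "K (i, k) = int n + 2 - int i" using K2 3 by simp
      moreover have "K (j, l) = int n + 2 - int j" using K2[of j l] 3 gh Z(3) by (auto simp: s_def)
      ultimately show ?thesis using h by (simp add: p(2) cross_def y y')
    qed
    then show "(y, y') \<in> Inv p" .
  qed
  moreover have "\<not> Inv (V x) \<subseteq> Inv p"
  proof -
    have "(t, s) \<in> Inv (V x)"
      using inversions_vee_word[OF X(1)] stT gh(5) by (simp add: s_def t_def)
    moreover have "(t, s) \<notin> Inv p" by (simp add: p(2) Ks Kt)
    ultimately show ?thesis by blast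
  qed
  moreover have "Inv (V x) \<subseteq> (Inv (V z) \<union> Inv p)\<^sup>+"
  proof (rule subrelI)
    fix y y' assume yy: "(y, y') \<in> Inv (V x)"
    obtain j l i k where y: "y = (j, l)" and y': "y' = (i, k)" by (cases y, cases y')
    have h: "(i, k) \<in> Tok" "(j, l) \<in> Tok" "i < j" "l \<le> x j" "x i < k"
      using yy inversions_vee_word[OF X(1)] unfolding y y' by blast+
    show "(y, y') \<in> (Inv (V z) \<union> Inv p)\<^sup>+"
    proof (cases "(y, y') = (t, s)")
      case False
      then have "(y, y') \<in> Inv p" using key[OF h] by (simp add: y y')
      then show ?thesis by auto
    next
      case True
      let ?f = "(f, z f)" and ?e = "(e, Suc (z e))"
      have fT: "?f \<in> Tok" by (rule first_token[OF z]) (use Z in auto)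
      have eT: "?e \<in> Tok" by (rule second_token) (use Z in auto)
      have "(?f, ?e) \<in> Inv (V z)"
        using inversions_vee_word[OF Z(1)] fT eT Z(3) by simp
      then have mid: "(?f, ?e) \<in> (Inv (V z) \<union> Inv p)\<^sup>*" by auto
      have left: "(t, ?f) \<in> (Inv (V z) \<union> Inv p)\<^sup>*"
      proof (cases "h = f")
        case True
        then show ?thesis using hf by (simp add: t_def)
      next
        case False
        then have 1: "f < h" "z f = Suc (x f)" using gh(3) A(5) by (auto simp: h_def split: if_splits)
        then have "K ?f = int n + 2 - int f" using K2[of f "z f"] gh Z(3) by (auto simp: s_def)
        then have "(t, ?f) \<in> Inv p" using 1 fT stT Z(4) Kt by (simp add: p(2) cross_def t_def)
        then show ?thesis by auto
      qed
      have right: "(?e, s) \<in> (Inv (V z) \<union> Inv p)\<^sup>*"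
      proof (cases "g = e")
        case True
        then show ?thesis using ge by (simp add: s_def)
      next
        case False
        then have 1: "g < e" "Suc (z e) = x e" using gh(2) A(4) by (auto simp: g_def split: if_splits)
        then have "K ?e = - int e" using K1[of "Suc (z e)" e] gh Z(3) by (auto simp: t_def)
        then have "(?e, s) \<in> Inv p" using 1 eT stT Z(2) Ks by (simp add: p(2) cross_def s_def)
        then show ?thesis by auto
      qed
      have "(t, s) \<in> (Inv (V z) \<union> Inv p)\<^sup>*" using left mid right by (meson rtrancl_trans)
      moreover have "t \<noteq> s" using gh(5) by (simp add: s_def t_def)
      ultimately show ?thesis using True by (simp add: rtrancl_eq_or_trancl)
    qed
  qed
  ultimately show ?thesis using p(1) by blast
qed

section \<open>A congruence that separates\<close>

text \<open>
  Applied in both directions, these bounds show that a join irreducible word determines the part of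
  its vector inside the plan, and the plan itself.
\<close>
lemma vee_word_le_bounds:
  assumes z: "has_plan z e f" and y: "has_plan y e' f'" and le: "Inv (V z) \<subseteq> Inv (V y)"
  shows "e' \<le> e" "f \<le> f'" "y e \<le> z e" "z f \<le> y f" "\<And>m. e < m \<Longrightarrow> m < f \<Longrightarrow> z m \<le> y m"
proof -
  note Z = has_planD[OF z] and Y = has_planD[OF y]
  have eT: "(e, Suc (z e)) \<in> Tok" by (rule second_token) (use Z in auto)
  have main: "z m \<le> y m \<and> (0 < z m \<longrightarrow> y e \<le> z e)" if "e < m" "m \<le> f" for m
  proof (cases "z m = 0")
    case False
    have "(m, z m) \<in> Tok" by (rule first_token[OF z]) (use that Z False in auto)
    then have "((m, z m), (e, Suc (z e))) \<in> Inv (V z)"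
      using eT that inversions_vee_word[OF Z(1)] by simp
    then have "((m, z m), (e, Suc (z e))) \<in> Inv (V y)" using le by blast
    then show ?thesis using inversions_vee_word[OF Y(1)] by simp
  qed simp
  then show "\<And>m. e < m \<Longrightarrow> m < f \<Longrightarrow> z m \<le> y m" by simp
  show 1: "z f \<le> y f" "y e \<le> z e" using main[of f] Z by auto
  show "f \<le> f'" using Y(8)[of f] 1 Z by simp
  show "e' \<le> e" using Y(7)[of e] 1 Z by simp
qed

lemma arc_le_vee_word_cong:
  assumes z: "has_plan z e f" and y: "has_plan y e' f'" and eq: "V z = V y"
    and "arc_le x a b z e f"
  shows "arc_le x a b y e' f'"
proof -
  have *: "Inv (V z) \<subseteq> Inv (V y)" "Inv (V y) \<subseteq> Inv (V z)" by (simp_all add: eq)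
  note b1 = vee_word_le_bounds[OF z y *(1)] and b2 = vee_word_le_bounds[OF y z *(2)]
  have ef: "e' = e" "f' = f" using b1(1,2) b2(1,2) by simp_all
  have "y e = z e" "y f = z f" using b1(3,4) b2(3,4) by (simp_all add: ef)
  moreover have "y m = z m" if "e < m" "m < f" for m
    using b1(5)[of m] b2(5)[of m] that by (simp add: ef)
  ultimately show ?thesis using assms(4) by (simp add: ef arc_le_def)
qed

text \<open>
  The vector with plan \<open>(i, j)\<close> that agrees with \<open>z\<close> strictly between \<open>i\<close> and \<open>j\<close> and has the
  descent formed by the tokens \<open>(j, l)\<close> and \<open>(i, Suc k)\<close>.
\<close>
definition subarc :: "(nat \<Rightarrow> nat) \<Rightarrow> nat \<Rightarrow> nat \<Rightarrow> nat \<Rightarrow> nat \<Rightarrow> nat \<Rightarrow> nat" where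
  "subarc z i k j l = (\<lambda>c. if c < i then v c else if c = i then k
     else if c < j then z c else if c = j then l else 0)"

lemma has_plan_subarc:
  assumes "has_plan z e f" "e \<le> i" "i < j" "j \<le> f" "k < v i" "0 < l" "l \<le> v j"
  shows "has_plan (subarc z i k j l) i j"
  using assms by (auto simp: has_plan_def subarc_def)

lemma arc_le_subarc:
  assumes "arc_le x a b z e f" "e \<le> i" "i < j" "j \<le> f"
    and "k = x i \<or> i \<noteq> a \<and> Suc k = x i" "l = x j \<or> j \<noteq> b \<and> l = Suc (x j)"
  shows "arc_le x a b (subarc z i k j l) i j"
  using assms by (auto simp: arc_le_def subarc_def)

lemma pos_le_length:
  assumes "w \<in> W" "s \<in> Tok"
  shows "pos w s \<le> length w"
proof -
  obtain m where "m < length w" "s = tok w m" using token_is_tok[OF assms] .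
  then show ?thesis by (simp add: pos_tok)
qed

text \<open>
  This is where the shape of $\unlhd^{\bullet}$ enters. Let \<open>r\<close> be the join of \<open>p\<close> and \<open>q\<close>, and let \<open>r'\<close>
  be above \<open>p'\<close> and \<open>q\<close>. Write \<open>F m\<close> for the last copy of \<open>m\<close> in the
  first block of \<open>z\<close> and \<open>G m\<close> for its first copy in the second block. The proof is by induction
  on the length of the plan. All pairs except the
  descent of \<open>z\<close> belong to shorter subarcs and are covered by the induction hypothesis. For the
  descent, from \<open>F f\<close> to \<open>G e\<close>, there are three cases. If in \<open>r\<close> a token \<open>G m\<close> precedes \<open>G e\<close>, the
  earliest such token splits the arc in two shorter ones whose words are still below \<open>r\<close>; the right
  one is a part of \<open>z\<close>, the left one ends in \<open>G m\<close>, which is the reason why the last coordinate may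
  exceed that of \<open>x\<close> by 1. If a token \<open>F m\<close> follows \<open>F f\<close>, the latest such token does the same with
  the sides exchanged. Otherwise no token can lie between \<open>F f\<close> and \<open>G e\<close> on a chain of
  inversions, so that the descent is an inversion of \<open>p\<close> or \<open>q\<close> itself, and the whole word of \<open>z\<close>
  lies below that one.
\<close>
lemma vee_word_below_join:
  assumes W: "p \<in> W" "p' \<in> W" "q \<in> W" "r \<in> W" "r' \<in> W"
    and r: "Inv r = (Inv p \<union> Inv q)\<^sup>+"
    and r': "Inv p' \<subseteq> Inv r'" "Inv q \<subseteq> Inv r'"
    and pp': "\<And>z e f. has_plan z e f \<Longrightarrow> arc_le x a b z e f \<Longrightarrow>
      Inv (V z) \<subseteq> Inv p \<Longrightarrow> Inv (V z) \<subseteq> Inv p'"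
    and "has_plan z e f" "arc_le x a b z e f" "Inv (V z) \<subseteq> Inv r"
  shows "Inv (V z) \<subseteq> Inv r'"
  using assms(10-12)
proof (induction "f - e" arbitrary: z e f rule: less_induct)
  case less
  note z = less.prems(1) and zr = less.prems(3)
  note Z = has_planD[OF z]
  have arc: "a \<le> e" "f \<le> b" "\<And>i. e < i \<Longrightarrow> i < f \<Longrightarrow> z i = x i"
    "z e = x e \<or> e \<noteq> a \<and> Suc (z e) = x e" "z f = x f \<or> f \<noteq> b \<and> z f = Suc (x f)"
    using less.prems(2) by (auto simp: arc_le_def)
  define F where "F m = (m, z m)" for m
  define G where "G m = (m, Suc (z m))" for m
  have FT: "F m \<in> Tok" if "e < m" "m \<le> f" "0 < z m" for m
    unfolding F_def by (rule first_token[OF z]) (use that Z in auto)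
  have GT: "G m \<in> Tok" if "e \<le> m" "m < f" "z m < v m" for m
    unfolding G_def by (rule second_token) (use that Z in auto)
  have H: "pos r (F j) < pos r (G i)" if "e \<le> i" "i < j" "j \<le> f" "z i < v i" "0 < z j" for i j
    using vee_word_below_iff[OF z W(4)] zr that by (simp add: F_def G_def)
  have sub: "pos r' (j, l) < pos r' (i, Suc k)"
    if ij: "e \<le> i" "i < j" "j \<le> f" "j - i < f - e" and kl: "k < v i" "0 < l" "l \<le> v j"
      and x: "k = x i \<or> i \<noteq> a \<and> Suc k = x i" "l = x j \<or> j \<noteq> b \<and> l = Suc (x j)"
      and main: "pos r (j, l) < pos r (i, Suc k)"
      and F: "\<And>m. i < m \<Longrightarrow> m < j \<Longrightarrow> 0 < z m \<Longrightarrow> pos r (F m) < pos r (i, Suc k)"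
      and G: "\<And>m. i < m \<Longrightarrow> m < j \<Longrightarrow> z m < v m \<Longrightarrow> pos r (j, l) < pos r (G m)"
    for i j k l
  proof -
    define y where "y = subarc z i k j l"
    have yv: "y i = k" "y j = l" "\<And>m. i < m \<Longrightarrow> m < j \<Longrightarrow> y m = z m"
      using ij by (auto simp: y_def subarc_def)
    have y: "has_plan y i j" unfolding y_def by (rule has_plan_subarc[OF z ij(1-3) kl])
    have "arc_le x a b y i j" unfolding y_def by (rule arc_le_subarc[OF less.prems(2) ij(1-3) x])
    moreover have "Inv (V y) \<subseteq> Inv r"
      unfolding vee_word_below_iff[OF y W(4)]
    proof (intro allI impI)
      fix i' j' assume h: "i \<le> i' \<and> i' < j' \<and> j' \<le> j \<and> y i' < v i' \<and> 0 < y j'"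
      consider "i' = i" "j' = j" | "i' = i" "j' < j" | "i < i'" "j' = j" | "i < i'" "j' < j"
        using h by linarith
      then show "pos r (j', y j') < pos r (i', Suc (y i'))"
      proof cases
        case 1 then show ?thesis using main by (simp add: yv)
      next
        case 2 then show ?thesis using F[of j'] yv(3)[of j'] h by (simp add: yv(1) F_def)
      next
        case 3 then show ?thesis using G[of i'] yv(3)[of i'] h by (simp add: yv(2) G_def)
      next
        case 4 then show ?thesis using H[of i' j'] yv(3)[of i'] yv(3)[of j'] h ij by (simp add: F_def G_def)
      qed
    qed
    ultimately have "Inv (V y) \<subseteq> Inv r'" using less.hyps[OF ij(4) y] by blast
    moreover have "i \<le> i \<and> i < j \<and> j \<le> j \<and> y i < v i \<and> 0 < y j"
      using ij kl by (simp add: yv(1,2))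
    ultimately have "pos r' (j, y j) < pos r' (i, Suc (y i))"
      using vee_word_below_iff[OF y W(5)] by blast
    then show ?thesis by (simp add: yv(1,2))
  qed
  have xk: "z i = x i \<or> i \<noteq> a \<and> Suc (z i) = x i" if "e \<le> i" "i < f" for i
    using arc(3,4) that by (cases "i = e") auto
  have xl: "z j = x j \<or> j \<noteq> b \<and> z j = Suc (x j)" if "e < j" "j \<le> f" for j
    using arc(3,5) that by (cases "j = f") auto
  have zv: "z j \<le> v j" if "e \<le> j" "j \<le> f" for j using Z that by simp
  have inner: "pos r' (F j) < pos r' (G i)"
    if ij: "e \<le> i" "i < j" "j \<le> f" "z i < v i" "0 < z j" and ne: "(i, j) \<noteq> (e, f)" for i j
    unfolding F_def G_def
  proof (rule sub)
    show "j - i < f - e" using ij ne by auto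
    show "pos r (j, z j) < pos r (i, Suc (z i))" using H[OF ij] by (simp add: F_def G_def)
    show "z i = x i \<or> i \<noteq> a \<and> Suc (z i) = x i" using xk ij by simp
    show "z j = x j \<or> j \<noteq> b \<and> z j = Suc (x j)" using xl ij by simp
    show "z j \<le> v j" using zv ij by simp
    show "pos r (F m) < pos r (i, Suc (z i))" if "i < m" "m < j" "0 < z m" for m
      using H[of i m] ij that by (simp add: G_def)
    show "pos r (j, z j) < pos r (G m)" if "i < m" "m < j" "z m < v m" for m
      using H[of m j] ij that by (simp add: F_def)
  qed (use ij in simp_all)
  have top: "Inv (V z) \<subseteq> Inv r' \<or> pos r' (F f) < pos r' (G e)"
  proof -
    consider (A) "\<exists>m. e < m \<and> m < f \<and> z m < v m \<and> pos r (G m) < pos r (G e)"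
      | (B) "\<exists>m. e < m \<and> m < f \<and> 0 < z m \<and> pos r (F f) < pos r (F m)"
      | (C) "\<And>m. e < m \<Longrightarrow> m < f \<Longrightarrow> z m < v m \<Longrightarrow> pos r (G e) \<le> pos r (G m)"
        "\<And>m. e < m \<Longrightarrow> m < f \<Longrightarrow> 0 < z m \<Longrightarrow> pos r (F m) \<le> pos r (F f)"
      by (meson not_le)
    then show ?thesis
    proof cases
      case A
      let ?P = "\<lambda>m. e < m \<and> m < f \<and> z m < v m \<and> pos r (G m) < pos r (G e)"
      from A obtain m0 where m0: "?P m0" by blast
      obtain m where m: "?P m" "\<And>m'. ?P m' \<Longrightarrow> pos r (G m) \<le> pos r (G m')"
        using ex_has_least_nat[of ?P m0 "\<lambda>m. pos r (G m)", OF m0] by blast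
      have "pos r' (m, Suc (z m)) < pos r' (e, Suc (z e))"
      proof (rule sub)
        show "pos r (m, Suc (z m)) < pos r (G m')" if "e < m'" "m' < m" "z m' < v m'" for m'
        proof (cases "?P m'")
          case True
          have "pos r (G m) \<noteq> pos r (G m')"
          proof
            assume "pos r (G m) = pos r (G m')"
            then have "G m = G m'" using pos_inj[OF W(4) GT[of m] GT[of m']] m(1) True by simp
            then show False using that by (simp add: G_def)
          qed
          then show ?thesis using m(2)[OF True] by (simp add: G_def)
        next
          case False
          then show ?thesis using m(1) that by (simp add: G_def)
        qed
        show "pos r (m, Suc (z m)) < pos r (e, Suc (z e))" using m(1) by (simp add: G_def)
        show "pos r (F m') < pos r (e, Suc (z e))" if "e < m'" "m' < m" "0 < z m'" for m'
          using H[of e m'] that m(1) Z by (simp add: G_def)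
        show "Suc (z m) = x m \<or> m \<noteq> b \<and> Suc (z m) = Suc (x m)" using arc m(1) by simp
        show "z e = x e \<or> e \<noteq> a \<and> Suc (z e) = x e" by (rule arc(4))
        show "m - e < f - e" using m(1) by linarith
      qed (use m(1) Z in simp_all)
      moreover have "pos r' (F f) < pos r' (G m)" using inner[of m f] m(1) Z by simp
      ultimately show ?thesis by (simp add: G_def)
    next
      case B
      let ?P = "\<lambda>m. e < m \<and> m < f \<and> 0 < z m \<and> pos r (F f) < pos r (F m)"
      from B obtain m0 where m0: "?P m0" by blast
      have "\<forall>m. ?P m \<longrightarrow> pos r (F m) < Suc (length r)"
        using FT pos_le_length[OF W(4)] by (simp add: less_Suc_eq_le)
      then obtain m where m: "?P m" "\<And>m'. ?P m' \<Longrightarrow> pos r (F m') \<le> pos r (F m)"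
        using ex_has_greatest_nat[of ?P m0 "\<lambda>m. pos r (F m)", OF m0] by blast
      \<comment> \<open>The right part has its descent at \<open>F m\<close>, so its first coordinate is one less than \<open>x m\<close>.\<close>
      have S: "Suc (z m - 1) = z m" using m(1) by simp
      have "pos r' (f, z f) < pos r' (m, Suc (z m - 1))"
      proof (rule sub)
        show "pos r (F m') < pos r (m, Suc (z m - 1))" if "m < m'" "m' < f" "0 < z m'" for m'
        proof (cases "?P m'")
          case True
          have "pos r (F m) \<noteq> pos r (F m')"
          proof
            assume "pos r (F m) = pos r (F m')"
            then have "F m = F m'" using pos_inj[OF W(4) FT[of m] FT[of m']] m(1) True by simp
            then show False using that by (simp add: F_def)
          qed
          then show ?thesis using m(2)[OF True] unfolding S by (simp add: F_def)
        next
          case False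
          then show ?thesis using m(1) that unfolding S by (simp add: F_def)
        qed
        show "pos r (f, z f) < pos r (m, Suc (z m - 1))" using m(1) unfolding S by (simp add: F_def)
        show "pos r (f, z f) < pos r (G m')" if "m < m'" "m' < f" "z m' < v m'" for m'
          using H[of m' f] that m(1) Z by (simp add: F_def)
        show "z m - 1 < v m" using zv[of m] m(1) by linarith
        show "z m - 1 = x m \<or> m \<noteq> a \<and> Suc (z m - 1) = x m" using m(1) arc S by simp
        show "z f = x f \<or> f \<noteq> b \<and> z f = Suc (x f)" by (rule arc(5))
        show "f - m < f - e" using m(1) by linarith
        show "z f \<le> v f" using zv[of f] Z by simp
      qed (use m(1) Z in simp_all)
      moreover have "pos r' (F m) < pos r' (G e)" using inner[of e m] m(1) Z by simp
      ultimately show ?thesis unfolding S by (simp add: F_def)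
    next
      case C
      have fF: "F f \<in> Tok" and eG: "G e \<in> Tok" using FT GT Z by auto
      have lt: "pos r (F f) < pos r (G e)" using H[of e f] Z by simp
      have base: "Inv p \<subseteq> Inv r" "Inv q \<subseteq> Inv r"
        unfolding r by (auto intro: r_into_trancl')
      have inv_r: "(F f, G e) \<in> Inv r"
        using lt fF eG Z(3) by (simp add: F_def G_def inversions_iff)
      \<comment> \<open>In this case \<open>r\<close> keeps all of the first block before \<open>F f\<close> and all of the second after \<open>G e\<close>; so
      does every word below \<open>r\<close>.\<close>
      have one_step: "Inv (V z) \<subseteq> Inv w"
        if w: "w \<in> W" "Inv w \<subseteq> Inv r" "(F f, G e) \<in> Inv w" for w
        unfolding vee_word_below_iff[OF z w(1)]
      proof (intro allI impI)
        fix i j assume ij: "e \<le> i \<and> i < j \<and> j \<le> f \<and> z i < v i \<and> 0 < z j"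
        have jT: "F j \<in> Tok" and iT: "G i \<in> Tok" using FT GT ij by auto
        have "pos w (F j) \<le> pos w (F f)"
        proof (cases "j = f")
          case False
          then have "pos r (F j) \<le> pos r (F f)" using C(2)[of j] ij by simp
          then have "(F f, F j) \<notin> Inv r" by (simp add: inversions_def)
          then show ?thesis using w(2) False ij
            by (intro pos_mono_non_inversion[OF w(1) jT fF]) (auto simp: F_def)
        qed simp
        also have "\<dots> < pos w (G e)" using w(3) by (simp add: inversions_def)
        also have "\<dots> \<le> pos w (G i)"
        proof (cases "i = e")
          case False
          then have "pos r (G e) \<le> pos r (G i)" using C(1)[of i] ij by simp
          then have "(G i, G e) \<notin> Inv r" by (simp add: inversions_def)
          then show ?thesis using w(2) False ij
            by (intro pos_mono_non_inversion[OF w(1) eG iT]) (auto simp: G_def)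
        qed simp
        finally show "pos w (j, z j) < pos w (i, Suc (z i))" by (simp add: F_def G_def)
      qed
      have "(F f, G e) \<in> Inv p \<union> Inv q"
      proof (rule ccontr)
        assume not: "(F f, G e) \<notin> Inv p \<union> Inv q"
        from inv_r[unfolded r] obtain c
          where c': "(F f, c) \<in> Inv p \<union> Inv q" "(c, G e) \<in> (Inv p \<union> Inv q)\<^sup>+"
          by (rule converse_tranclE) (use not in blast)
        have c: "(F f, c) \<in> Inv r" "(c, G e) \<in> Inv r"
          using c'(1) base by blast (rule c'(2)[folded r])
        obtain m k where mk: "c = (m, k)" by (cases c)
        have m: "e < m" "m < f"
          using inversion_letters[OF W(4)] c unfolding mk F_def G_def by blast+
        have cT: "(m, k) \<in> Tok" and pc: "pos r (F f) < pos r (m, k)" "pos r (m, k) < pos r (G e)"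
          using c unfolding mk inversions_def by simp_all
        have k: "1 \<le> k" "k \<le> v m" using cT by (auto simp: tokens_def)
        show False
        proof (cases "k \<le> z m")
          case True
          then have "0 < z m" using k by simp
          then have "pos r (m, k) \<le> pos r (F m)"
            unfolding F_def by (intro pos_copy_le[OF W(4) cT] FT[of m, unfolded F_def]) (use m True in auto)
          then show False using C(2)[of m] m \<open>0 < z m\<close> pc by simp
        next
          case False
          then have "z m < v m" using k by simp
          then have "pos r (G m) \<le> pos r (m, k)"
            unfolding G_def by (intro pos_copy_le[OF W(4) _ cT] GT[of m, unfolded G_def]) (use m False in auto)
          then show False using C(1)[of m] m \<open>z m < v m\<close> pc by simp
        qed
      qed
      then show ?thesis
      proof
        assume "(F f, G e) \<in> Inv p"
        then have "Inv (V z) \<subseteq> Inv p" by (rule one_step[OF W(1) base(1)])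
        from pp'[OF z less.prems(2) this] r'(1) have "Inv (V z) \<subseteq> Inv r'" by (rule subset_trans)
        then show ?thesis ..
      next
        assume "(F f, G e) \<in> Inv q"
        then have "Inv (V z) \<subseteq> Inv q" by (rule one_step[OF W(3) base(2)])
        from this r'(2) have "Inv (V z) \<subseteq> Inv r'" by (rule subset_trans)
        then show ?thesis ..
      qed
    qed
  qed
  show ?case
  proof (rule ccontr)
    assume not: "\<not> Inv (V z) \<subseteq> Inv r'"
    then have "pos r' (F f) < pos r' (G e)" using top by blast
    then have "pos r' (F j) < pos r' (G i)"
      if "e \<le> i" "i < j" "j \<le> f" "z i < v i" "0 < z j" for i j
      using inner[OF that] by (cases "(i, j) = (e, f)") auto
    then have "Inv (V z) \<subseteq> Inv r'"
      unfolding vee_word_below_iff[OF z W(5)] by (simp add: F_def G_def)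
    then show False using not by blast
  qed
qed

lemma arc_le_refl: "a < b \<Longrightarrow> arc_le x a b x a b"
  by (simp add: arc_le_def)

text \<open>
  The words of all vectors \<open>y\<close> with $x \unlhd^{\bullet} y$, used as detectors, define a congruence. It
  identifies the word of a join irreducible \<open>z\<close> outside this set with its lower cover, because every
  detector below the word of \<open>z\<close> is then strictly below it, hence below the cover. It does not identify the word of \<open>x\<close> with its lower
  cover, because \<open>x\<close> is a detector itself.
\<close>
lemma principal_congruence_imp_arc_le:
  assumes x: "has_plan x a b" "join_irreducible M (V x)"
    and z: "has_plan z e f" "join_irreducible M (V z)"
    and mem: "(V x, the_lower_cover M (V x)) \<in> principal_congruence M (V z) (the_lower_cover M (V z))"
  shows "arc_le x a b z e f"
proof (rule ccontr)
  assume no: "\<not> arc_le x a b z e f"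
  interpret lattice M by (rule lattice_multinomial)
  have fin: "finite (carrier M)" by (simp add: carrier_multinomial finite_words)
  let ?S = "{V y |y e f. has_plan y e f \<and> arc_le x a b y e f}"
  let ?R = "{(p, p'). p \<in> carrier M \<and> p' \<in> carrier M \<and>
    (\<forall>s\<in>?S. s \<sqsubseteq>\<^bsub>M\<^esub> p \<longleftrightarrow> s \<sqsubseteq>\<^bsub>M\<^esub> p')}"
  have SW: "?S \<subseteq> W" using has_planD(9) by blast
  have cong: "lattice_congruence M ?R"
  proof (rule lattice_congruence_detectors)
    show "?S \<subseteq> carrier M" using SW by (simp add: carrier_multinomial)
    fix p p' q s
    assume C: "p \<in> carrier M" "p' \<in> carrier M" "q \<in> carrier M" and s: "s \<in> ?S"
      and eq: "\<And>t. t \<in> ?S \<Longrightarrow> t \<sqsubseteq>\<^bsub>M\<^esub> p \<longleftrightarrow> t \<sqsubseteq>\<^bsub>M\<^esub> p'"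
      and le: "s \<sqsubseteq>\<^bsub>M\<^esub> p \<squnion>\<^bsub>M\<^esub> q"
    have pq: "p \<in> W" "p' \<in> W" "q \<in> W" using C by (simp_all add: carrier_multinomial)
    obtain y e f where y: "s = V y" "has_plan y e f" "arc_le x a b y e f" using s by blast
    have "Inv (V y) \<subseteq> Inv (p' \<squnion>\<^bsub>M\<^esub> q)"
    proof (rule vee_word_below_join[of p p' q "p \<squnion>\<^bsub>M\<^esub> q" "p' \<squnion>\<^bsub>M\<^esub> q"])
      show "Inv (V y') \<subseteq> Inv p'"
        if y': "has_plan y' e' f'" "arc_le x a b y' e' f'" "Inv (V y') \<subseteq> Inv p" for y' e' f'
      proof -
        have "V y' \<in> ?S" using y'(1,2) by blast
        then have "V y' \<sqsubseteq>\<^bsub>M\<^esub> p \<longleftrightarrow> V y' \<sqsubseteq>\<^bsub>M\<^esub> p'" by (rule eq)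
        then show ?thesis using y'(3) pq has_planD(9)[OF y'(1)] by (simp add: le_multinomial)
      qed
      show "Inv (V y) \<subseteq> Inv (p \<squnion>\<^bsub>M\<^esub> q)"
        using le y pq inversions_join(1) has_planD(9)[OF y(2)] by (simp add: le_multinomial)
      show "p \<squnion>\<^bsub>M\<^esub> q \<in> W" "p' \<squnion>\<^bsub>M\<^esub> q \<in> W"
        "Inv (p \<squnion>\<^bsub>M\<^esub> q) = (Inv p \<union> Inv q)\<^sup>+"
        using pq inversions_join by simp_all
      show "Inv p' \<subseteq> Inv (p' \<squnion>\<^bsub>M\<^esub> q)" "Inv q \<subseteq> Inv (p' \<squnion>\<^bsub>M\<^esub> q)"
        unfolding inversions_join(2)[OF pq(2,3)] by (auto intro: r_into_trancl')
    qed (fact pq y)+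
    then show "s \<sqsubseteq>\<^bsub>M\<^esub> p' \<squnion>\<^bsub>M\<^esub> q"
      using y pq inversions_join(1) has_planD(9)[OF y(2)] by (simp add: le_multinomial)
  qed
  have collapsed: "(V z, the_lower_cover M (V z)) \<in> ?R"
  proof -
    let ?c = "the_lower_cover M (V z)"
    have c: "?c \<in> carrier M" "V z \<in> carrier M" "?c \<sqsubseteq>\<^bsub>M\<^esub> V z"
      using below_the_lower_cover(1)[OF fin z(2)] by (auto simp: lower_cover_def lless_eq)
    have "s \<sqsubseteq>\<^bsub>M\<^esub> V z \<longleftrightarrow> s \<sqsubseteq>\<^bsub>M\<^esub> ?c" if s: "s \<in> ?S" for s
    proof
      have sC: "s \<in> carrier M" using s SW by (auto simp: carrier_multinomial)
      show "s \<sqsubseteq>\<^bsub>M\<^esub> ?c \<Longrightarrow> s \<sqsubseteq>\<^bsub>M\<^esub> V z" using le_trans[of s ?c "V z"] c sC by blast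
      obtain y e' f' where y: "s = V y" "has_plan y e' f'" "arc_le x a b y e' f'" using s by blast
      have "s \<noteq> V z"
      proof
        assume "s = V z"
        then have "V y = V z" using y(1) by simp
        then show False using arc_le_vee_word_cong[OF y(2) z(1) _ y(3)] no by blast
      qed
      then show "s \<sqsubseteq>\<^bsub>M\<^esub> V z \<Longrightarrow> s \<sqsubseteq>\<^bsub>M\<^esub> ?c"
        using below_the_lower_cover(2)[OF fin z(2) sC] by blast
    qed
    then show ?thesis unfolding mem_Collect_eq prod.case using c(1,2) by blast
  qed
  have "principal_congruence M (V z) (the_lower_cover M (V z)) \<subseteq> ?R"
    unfolding principal_congruence_def
    by (rule Inter_lower, rule CollectI, rule conjI[OF cong collapsed])
  from subsetD[OF this mem] have "(V x, the_lower_cover M (V x)) \<in> ?R" .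
  then have "\<forall>s\<in>?S. s \<sqsubseteq>\<^bsub>M\<^esub> V x \<longleftrightarrow> s \<sqsubseteq>\<^bsub>M\<^esub> the_lower_cover M (V x)"
    unfolding mem_Collect_eq prod.case by (elim conjE)
  moreover have "V x \<in> ?S" using x(1) arc_le_refl has_planD(3)[OF x(1)] by blast
  moreover have "V x \<in> carrier M" using x(2) by (simp add: join_irreducible_def)
  moreover from this have "V x \<sqsubseteq>\<^bsub>M\<^esub> V x" by simp
  ultimately have "V x \<sqsubseteq>\<^bsub>M\<^esub> the_lower_cover M (V x)" by blast
  moreover have "the_lower_cover M (V x) \<in> carrier M" "the_lower_cover M (V x) \<sqsubset>\<^bsub>M\<^esub> V x"
    using below_the_lower_cover(1)[OF fin x(2)] by (auto simp: lower_cover_def)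
  ultimately show False
    using le_antisym[of "V x" "the_lower_cover M (V x)"] \<open>V x \<in> carrier M\<close> by (simp add: lless_eq)
qed

text \<open>
  The lower cover of the word of \<open>z\<close> misses at least the descent, so it lies below the separating
  word, and the perspectivity argument applies.
\<close>
lemma arc_le_imp_principal_congruence:
  assumes x: "has_plan x a b" "join_irreducible M (V x)"
    and z: "has_plan z e f" "join_irreducible M (V z)"
    and arc: "arc_le x a b z e f"
  shows "(V x, the_lower_cover M (V x)) \<in> principal_congruence M (V z) (the_lower_cover M (V z))"
proof -
  interpret lattice M by (rule lattice_multinomial)
  have fin: "finite (carrier M)" by (simp add: carrier_multinomial finite_words)
  let ?c = "the_lower_cover M (V z)"
  have VW: "V x \<in> W" "V z \<in> W" using has_planD(9) x(1) z(1) by blast+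
  have c: "?c \<in> W" "?c \<sqsubseteq>\<^bsub>M\<^esub> V z" "?c \<noteq> V z"
    using below_the_lower_cover(1)[OF fin z(2)] by (auto simp: lower_cover_def lless_eq carrier_multinomial)
  then have le: "Inv ?c \<subseteq> Inv (V z)" using VW by (simp add: le_multinomial)
  then have "((f, z f), (e, Suc (z e))) \<notin> Inv ?c"
    using descent_only_on_top[OF z(1) c(1)] c(3) by blast
  then have sub: "Inv ?c \<subseteq> Inv (V z) - {((f, z f), (e, Suc (z e)))}" using le by blast
  obtain p where p: "p \<in> W" "Inv (V z) - {((f, z f), (e, Suc (z e)))} \<subseteq> Inv p"
    "\<not> Inv (V x) \<subseteq> Inv p" "Inv (V x) \<subseteq> (Inv (V z) \<union> Inv p)\<^sup>+"
    using ex_separating_word[OF x(1) z(1) arc] by blast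
  show ?thesis
  proof (rule in_principal_congruence[OF fin x(2)])
    show "V z \<in> carrier M" "?c \<in> carrier M" "p \<in> carrier M"
      using VW c p by (simp_all add: carrier_multinomial)
    show "?c \<sqsubseteq>\<^bsub>M\<^esub> p" using sub p c by (simp add: le_multinomial)
    show "V x \<sqsubseteq>\<^bsub>M\<^esub> V z \<squnion>\<^bsub>M\<^esub> p"
      using p VW inversions_join[of "V z" p] by (simp add: le_multinomial)
    show "\<not> V x \<sqsubseteq>\<^bsub>M\<^esub> p" using p VW by (simp add: le_multinomial)
  qed
qed

end

theorem corollary3p9:
  fixes n :: nat and v x z :: "nat \<Rightarrow> nat"
  defines "L \<equiv> multinomial_lattice n v"
  assumes "\<forall>i\<in>{1..n}. x i \<le> v i" and "join_irreducible L (vee_word n v x)"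
    and "\<forall>i\<in>{1..n}. z i \<le> v i" and "join_irreducible L (vee_word n v z)"
  shows "(vee_word n v x, the_lower_cover L (vee_word n v x))
           \<in> principal_congruence L (vee_word n v z) (the_lower_cover L (vee_word n v z))
         \<longleftrightarrow> vee_rel n v x z"
proof -
  have x: "has_plan n v x (min_vee n v x) (max_vee n x)"
    using join_irreducible_has_plan assms unfolding L_def by blast
  have z: "has_plan n v z (min_vee n v z) (max_vee n z)"
    using join_irreducible_has_plan assms unfolding L_def by blast
  show ?thesis
    unfolding vee_rel_iff_arc_le[OF has_planD(3)[OF z]] L_def
    using principal_congruence_imp_arc_le[OF x _ z] arc_le_imp_principal_congruence[OF x _ z] assms
    unfolding L_def by blast
qed

end
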